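(* Let $\Theta\in\mathbb{R}^{d_1\times d_2}$ have rank $r\ge 1$, with singular value decomposition $\Theta=UDV^\top$ and nonzero singular values $s_1\ge\cdots\ge s_r$. Let $y_i=\Theta_{\omega_i}+\varepsilon_i$, $i=1,\dots,n$, with $\omega_i\in\{1,\dots,d_1\}\times\{1,\dots,d_2\}$ and errors $\varepsilon_i\in\mathbb{R}$. Let $\lambda_1\ge 0$, $\lambda_2>0$, $\pi_0=n/(d_1d_2)$, and let $\widehat\Theta=(1+\lambda_2/\pi_0)\widetilde\Theta$ be the calibrated spectrum elastic net estimator, where $$\widetilde\Theta=\arg\min_{M\in\mathbb{R}^{d_1\times d_2}}\Big\{\sum_{i=1}^n M_{\omega_i}^2/2-\sum_{i=1}^n y_iM_{\omega_i}+\lambda_1\|M\|_{(N)}+(\lambda_2/2)\|M\|_{(F)}^2\Big\}.$$ With $\mathcal{P}_T$ and $\mathcal{H}$ as in the context, define $$\mathcal{R}=(\mathcal{H}-\pi_0\mathcal{I})\mathcal{P}_T/(\pi_0+\lambda_2),\qquad \overline\Delta=\mathcal{R}(\lambda_2\Theta+\lambda_1UV^\top),$$ $$\mathcal{Q}=\mathcal{I}-\mathcal{H}(\mathcal{P}_T\mathcal{H}\mathcal{P}_T+\lambda_2\mathcal{P}_T)^{-1}\mathcal{P}_T,\qquad \varepsilon=\sum_{i=1}^n\varepsilon_iE_{\omega_i}\in\mathbb{R}^{d_1\times d_2}.$$ Suppose that $$\|\mathcal{P}_T\mathcal{R}\|_{(op)}\le 1/2,\qquad s_r\ge 5\lambda_1/\lambda_2,$$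 $$\|\mathcal{P}_T\overline\Delta\|_{(F)}\le\sqrt r\,\lambda_1/8,\qquad \big\|\overline\Delta-\mathcal{R}(\mathcal{P}_T\mathcal{R}+\mathcal{P}_T)^{-1}\mathcal{P}_T\overline\Delta\big\|_{(S)}\le\lambda_1/4,$$ $$\|\mathcal{P}_T\varepsilon\|_{(F)}\le\sqrt r\,\lambda_1/8,\qquad \|\mathcal{Q}\varepsilon\|_{(S)}\le 3\lambda_1/4,\qquad \|\mathcal{P}_T^\perp\varepsilon\|_{(S)}\le\lambda_1.$$ Then $$\|\widehat\Theta-\Theta\|_{(F)}\le 2\sqrt r\,\lambda_1/\pi_0.$$
   Context: $\|\cdot\|_{(N)}$, $\|\cdot\|_{(S)}$, $\|\cdot\|_{(F)}$ denote the nuclear norm (sum of singular values), spectral norm (largest singular value) and Frobenius norm of a matrix. Calligraphic letters denote linear maps $\mathbb{R}^{d_1\times d_2}\to\mathbb{R}^{d_1\times d_2}$; $\mathcal{I}$ is the identity, and $\|\mathcal{Q}\|_{(op)}=\sup_{\|M\|_{(F)}=1}\|\mathcal{Q}M\|_{(F)}$. The inner product is $\langle M_1,M_2\rangle=\mathrm{trace}(M_1^\top M_2)$. The SVD $\Theta=UDV^\top$ is the compact one: $U\in\mathbb{R}^{d_1\times r}$ and $V\in\mathbb{R}^{d_2\times r}$ have orthonormal columns and $D=\mathrm{diag}(s_1,\dots,s_r)$. $E_\omega$ is the $d_1\times d_2$ matrix with entry $1$ at position $\omega$ and $0$ elsewhere; $\mathcal{P}_\omega M=M_\omega E_\omega$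 is the projection onto $E_\omega$; $\mathcal{H}=\sum_{i=1}^n\mathcal{P}_{\omega_i}$ (the $\omega_i$ may have ties, counted with multiplicity). $T$ is the space of all matrices of the form $UU^\top M_1+M_2VV^\top$, and $\mathcal{P}_T$ is the orthogonal projection onto $T$: $\mathcal{P}_TM=UU^\top M+MVV^\top-UU^\top MVV^\top$; $\mathcal{P}_T^\perp=\mathcal{I}-\mathcal{P}_T$. The inverses $(\mathcal{P}_T\mathcal{H}\mathcal{P}_T+\lambda_2\mathcal{P}_T)^{-1}$ and $(\mathcal{P}_T\mathcal{R}+\mathcal{P}_T)^{-1}$ are inverses of these maps viewed as linear maps $T\to T$. *)

theory Defs
  imports "HOL-Analysis.Analysis"
begin

text \<open>
  A \<open>d\<^sub>1 \<times> d\<^sub>2\<close> matrix has type \<open>real^'d2^'d1\<close>. On this type the library's \<open>norm\<close> is the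
  Frobenius norm (the Euclidean norm of the vector of row norms) and the library's inner
  product is \<open>trace (M\<^sub>1\<^sup>T M\<^sub>2)\<close>.
\<close>

section \<open>Singular values and matrix norms\<close>

text \<open>
  The eigenspace is that of \<open>A\<^sup>T A\<close> for the eigenvalue \<open>\<sigma>\<^sup>2\<close>. As \<open>A\<^sup>T A\<close> is symmetric, its
  dimension is the multiplicity of \<open>\<sigma>\<close> as a singular value, and \<open>singular_values A\<close> is
  finite and nonempty. For \<open>\<sigma> = 0\<close> the multiplicity refers to the \<open>d\<^sub>2\<close> eigenvalues of
  \<open>A\<^sup>T A\<close>; this affects neither the sum nor the maximum below.
\<close>

definition singular_space :: "real^'n^'m \<Rightarrow> real \<Rightarrow> (real^'n) set" where
  "singular_space A \<sigma> = {v. (transpose A ** A) *v v = \<sigma>\<^sup>2 *\<^sub>R v}"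

definition singular_values :: "real^'n^'m \<Rightarrow> real set" where
  "singular_values A = {\<sigma>. \<sigma> \<ge> 0 \<and> (\<exists>v \<in> singular_space A \<sigma>. v \<noteq> 0)}"

definition nuclear_norm :: "real^'n^'m \<Rightarrow> real" where
  "nuclear_norm A = (\<Sum>\<sigma>\<in>singular_values A. real (dim (singular_space A \<sigma>)) * \<sigma>)"

definition spectral_norm :: "real^'n^'m \<Rightarrow> real" where
  "spectral_norm A = Max (singular_values A)"

text \<open>
  The index type \<open>'r\<close> plays the role of \<open>{1, \<dots>, r}\<close>, so \<open>s (Max UNIV)\<close> is the smallest
  nonzero singular value \<open>s\<^sub>r\<close>.
\<close>

definition compact_svd ::
  "real^'d2^'d1 \<Rightarrow> real^('r::{finite,linorder})^'d1 \<Rightarrow> ('r \<Rightarrow> real)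
    \<Rightarrow> real^('r::{finite,linorder})^'d2 \<Rightarrow> bool" where
  "compact_svd \<Theta> U s V \<longleftrightarrow>
     transpose U ** U = mat 1 \<and> transpose V ** V = mat 1 \<and>
     (\<forall>i. s i > 0) \<and> antimono s \<and>
     \<Theta> = U ** (\<chi> i j. if i = j then s i else 0) ** transpose V"

section \<open>The sampling operator and the estimator\<close>

definition entry :: "real^'d2^'d1 \<Rightarrow> 'd1 \<times> 'd2 \<Rightarrow> real" where
  "entry M w = M $ fst w $ snd w"

definition unit_mat :: "'d1 \<times> 'd2 \<Rightarrow> real^'d2^'d1" where
  "unit_mat w = axis (fst w) (axis (snd w) 1)"

definition proj_entry :: "'d1 \<times> 'd2 \<Rightarrow> real^'d2^'d1 \<Rightarrow> real^'d2^'d1" where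
  "proj_entry w M = entry M w *\<^sub>R unit_mat w"

definition sampling_op :: "nat \<Rightarrow> (nat \<Rightarrow> 'd1 \<times> 'd2) \<Rightarrow> real^'d2^'d1 \<Rightarrow> real^'d2^'d1" where
  "sampling_op n \<omega> M = (\<Sum>i=1..n. proj_entry (\<omega> i) M)"

definition elastic_net_loss ::
  "nat \<Rightarrow> (nat \<Rightarrow> 'd1 \<times> 'd2) \<Rightarrow> (nat \<Rightarrow> real) \<Rightarrow> real \<Rightarrow> real \<Rightarrow> real^'d2^'d1 \<Rightarrow> real" where
  "elastic_net_loss n \<omega> y lam1 lam2 M =
     (\<Sum>i=1..n. (entry M (\<omega> i))\<^sup>2 / 2) - (\<Sum>i=1..n. y i * entry M (\<omega> i))
     + lam1 * nuclear_norm M + (lam2 / 2) * (norm M)\<^sup>2"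

section \<open>The tangent space\<close>

definition tangent_space :: "real^'r^'d1 \<Rightarrow> real^'r^'d2 \<Rightarrow> (real^'d2^'d1) set" where
  "tangent_space U V = {U ** transpose U ** M1 + M2 ** V ** transpose V | M1 M2. True}"

definition proj_T :: "real^'r^'d1 \<Rightarrow> real^'r^'d2 \<Rightarrow> real^'d2^'d1 \<Rightarrow> real^'d2^'d1" where
  "proj_T U V M =
     U ** transpose U ** M + M ** V ** transpose V - U ** transpose U ** M ** V ** transpose V"

end

theory Submission
  imports Defs
begin

text \<open>
  Put \<open>S = \<pi>\<^sub>0 + lam2\<close> and \<open>J = H + lam2 I\<close>. Since \<open>\<Theta>hat - \<Theta> = (S / \<pi>\<^sub>0) (\<Theta>til - M0)\<close> with
  \<open>M0 = (\<pi>\<^sub>0 / S) \<Theta>\<close>, the claim says that the uncalibrated estimator \<open>\<Theta>til\<close> lies within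
  \<open>2 sqrt r lam1 / S\<close> of \<open>M0\<close>.

  The proof compares \<open>\<Theta>til\<close> with an explicit oracle \<open>X\<close>. If the sampling were perfect
  (\<open>H = \<pi>\<^sub>0 I\<close>) and the noise absent, soft thresholding would suggest
  \<open>(\<pi>\<^sub>0 \<Theta> - lam1 U V\<^sup>T) / S\<close>. The oracle is this matrix plus the correction \<open>D\<close> in \<open>T\<close> that
  makes the \<open>T\<close>-component of the optimality system exact:
  \<open>S (P R + I) D = P (\<Delta>bar + \<epsilon>)\<close> on \<open>T\<close>. Because \<open>P R\<close> has operator norm at most \<open>1/2\<close>, this
  system is solvable (\<open>inv_into_perturbed_projection\<close>) and \<open>D\<close> has norm at most
  \<open>sqrt r lam1 / (2 S)\<close>. The residual \<open>W\<close> then lies in the orthogonal complement of \<open>T\<close>, and there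
  it is the complementary projection of \<open>Q \<epsilon> + (\<Delta>bar - R (P R + P)\<^sup>-\<^sup>1 P \<Delta>bar)\<close>, whose spectral
  norm is at most \<open>3 lam1 / 4 + lam1 / 4\<close>. So \<open>lam1 U V\<^sup>T + W\<close> has spectral norm at most \<open>lam1\<close>
  (\<open>norm_certificate_mult_vector_le\<close>) and is a dual certificate. Combined with the first-order
  condition for the minimiser (\<open>elastic_net_variational_inequality\<close>) and the duality of the
  spectral and nuclear norms (\<open>inner_le_nuclear_norm\<close>) this gives, for every \<open>M\<close> in \<open>T\<close>,
  \<open>\<langle>J (\<Theta>til - X), \<Theta>til - M\<rangle> \<le> lam1 (\<parallel>M\<parallel>\<^sub>N - \<langle>U V\<^sup>T, M\<rangle>)\<close>.

  The right side would vanish if \<open>U V\<^sup>T\<close> were a subgradient at \<open>M\<close>. The singular spaces of \<open>X\<close>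
  differ from those of \<open>\<Theta>\<close>, so at \<open>X\<close> it is only nearly one, but the defect is of second order
  (\<open>nuclear_norm_gap\<close>): it is at most \<open>\<parallel>D\<parallel>\<^sup>2 / \<beta>\<close> if the singular values before the correction
  are at least \<open>\<beta>\<close>. Two regimes remain.

  If \<open>lam2 \<le> 2 \<pi>\<^sub>0\<close>, take \<open>M = X\<close>. The assumption on the smallest singular value yields
  \<open>lam1 \<le> lam2 \<beta>\<close>, and \<open>lam2\<close>-strong convexity gives \<open>\<parallel>\<Theta>til - X\<parallel> \<le> \<parallel>D\<parallel>\<close>; the triangle
  inequality finishes with \<open>1/2 + 1/2 + 1 = 2\<close>.

  If \<open>lam2 > 2 \<pi>\<^sub>0\<close>, the thresholded singular values may be negative, but \<open>J\<close> is well conditioned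
  on \<open>T\<close>. Take \<open>M = M0\<close>, where the defect is zero. With \<open>Y = \<Theta>til - M0\<close> and \<open>B = X - M0\<close> the
  inequality reads \<open>\<langle>J (Y - B), Y\<rangle> \<le> 0\<close>, so \<open>Y\<close> is no longer than \<open>B\<close> in the norm induced by
  \<open>J\<close>; as \<open>B\<close> lies in \<open>T\<close>, that norm of \<open>B\<close> is controlled by \<open>P R\<close>.
\<close>

section \<open>Spectral theorem for self-adjoint maps\<close>

text \<open>
  A maximiser \<open>x\<close> of the Rayleigh quotient on the unit sphere of \<open>S\<close> is an eigenvector: the form
  of \<open>\<mu> I - f\<close> is nonnegative on \<open>S\<close> and vanishes at \<open>x\<close>, so its derivative at \<open>x\<close> in the
  direction \<open>z = \<mu> x - f x\<close>, which is \<open>2 \<parallel>z\<parallel>\<^sup>2\<close>, must be zero.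
\<close>

lemma selfadjoint_eigenvector_exists:
  fixes f :: "'a::euclidean_space \<Rightarrow> 'a"
  assumes f: "linear f" and S: "subspace S" and inv: "f ` S \<subseteq> S"
    and sa: "\<And>x y. f x \<bullet> y = x \<bullet> f y" and nz: "S \<noteq> {0}"
  obtains x \<mu> where "x \<in> S" "norm x = 1" "f x = \<mu> *\<^sub>R x"
proof -
  obtain w where w: "w \<in> S" "w \<noteq> 0" using nz subspace_0[OF S] by blast
  have "compact (S \<inter> sphere 0 1)"
    using closed_subspace[OF S] by (simp add: closed_Int_compact)
  moreover have "w /\<^sub>R norm w \<in> S \<inter> sphere 0 1"
    using w S by (simp add: subspace_scale)
  hence "S \<inter> sphere 0 1 \<noteq> {}" by blast
  moreover have "continuous_on (S \<inter> sphere 0 1) (\<lambda>x. f x \<bullet> x)"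
    using linear_continuous_on_compose[OF continuous_on_id f] by (intro continuous_intros) simp_all
  ultimately obtain x where x0: "x \<in> S \<inter> sphere 0 1"
    and max0: "\<forall>y\<in>S \<inter> sphere 0 1. f y \<bullet> y \<le> f x \<bullet> x"
    using continuous_attains_sup[of "S \<inter> sphere 0 1" "\<lambda>x. f x \<bullet> x"] by blast
  have x: "x \<in> S" "norm x = 1"
    and max: "\<And>y. y \<in> S \<Longrightarrow> norm y = 1 \<Longrightarrow> f y \<bullet> y \<le> f x \<bullet> x"
    using x0 max0 by auto
  define \<mu> where "\<mu> = f x \<bullet> x"
  define z where "z = \<mu> *\<^sub>R x - f x"
  have zS: "z \<in> S" using x inv S by (auto simp: z_def intro!: subspace_diff subspace_scale)
  have quad: "f y \<bullet> y \<le> \<mu> * (y \<bullet> y)" if "y \<in> S" for y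
  proof (cases "y = 0")
    case True thus ?thesis using linear_0[OF f] by simp
  next
    case False
    have "f (y /\<^sub>R norm y) \<bullet> (y /\<^sub>R norm y) \<le> \<mu>"
      unfolding \<mu>_def using False that S by (intro max) (auto simp: subspace_scale)
    hence "(f y \<bullet> y) / (norm y)\<^sup>2 \<le> \<mu>"
      by (simp add: linear_cmul[OF f] power2_eq_square divide_simps)
    thus ?thesis using False by (simp add: power2_norm_eq_inner divide_simps split: if_splits)
  qed
  have "z \<bullet> z = 0"
  proof (rule ccontr)
    assume "z \<bullet> z \<noteq> 0"
    hence zz: "z \<bullet> z > 0" by simp
    define g where "g = \<mu> * (z \<bullet> z) - f z \<bullet> z"
    have g: "g \<ge> 0" using quad[OF zS] by (simp add: g_def)
    have key: "0 \<le> - 2 * t * (z \<bullet> z) + t\<^sup>2 * g" for t :: real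
    proof -
      have "x - t *\<^sub>R z \<in> S" using x zS S by (simp add: subspace_diff subspace_scale)
      from quad[OF this] have "0 \<le> \<mu> * (x \<bullet> x) - f x \<bullet> x - 2 * t * (z \<bullet> (\<mu> *\<^sub>R x - f x)) + t\<^sup>2 * g"
        by (simp add: linear_diff[OF f] linear_cmul[OF f] g_def inner_diff_left inner_diff_right
            sa[of z x] inner_commute[of x z] inner_commute[of "f x" z] power2_eq_square algebra_simps)
      thus ?thesis using x(2) by (simp add: \<mu>_def[symmetric] z_def[symmetric] norm_eq_1)
    qed
    \<comment> \<open>the shift keeps the denominator positive when \<open>g = 0\<close>; any small \<open>t\<close> makes the linear term dominate\<close>
    define t where "t = (z \<bullet> z) / (g + 1)"
    have "t > 0" using zz g by (simp add: t_def)
    have "2 * t * (z \<bullet> z) \<le> t\<^sup>2 * g" using key[of t] by simp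
    hence "2 * (z \<bullet> z) \<le> t * g" using \<open>t > 0\<close> by (simp add: power2_eq_square)
    also have "\<dots> \<le> z \<bullet> z" using g zz by (simp add: t_def divide_simps)
    finally show False using zz by simp
  qed
  hence "f x = \<mu> *\<^sub>R x" by (simp add: z_def)
  with x show thesis using that by blast
qed

text \<open>
  Induction on the dimension: self-adjointness makes the orthogonal complement of an eigenvector
  inside \<open>S\<close> invariant again.
\<close>

lemma selfadjoint_orthonormal_eigenbasis:
  fixes f :: "'a::euclidean_space \<Rightarrow> 'a"
  assumes f: "linear f" and sa: "\<And>x y. f x \<bullet> y = x \<bullet> f y"
  shows "subspace S \<Longrightarrow> f ` S \<subseteq> S \<Longrightarrow>
    \<exists>B. finite B \<and> B \<subseteq> S \<and> span B = S \<and> pairwise orthogonal B \<and> (\<forall>v\<in>B. norm v = 1 \<and> (\<exists>\<mu>. f v = \<mu> *\<^sub>R v))"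
proof (induction "dim S" arbitrary: S rule: less_induct)
  case less
  show ?case
  proof (cases "S = {0}")
    case True
    thus ?thesis by (intro exI[of _ "{}"]) auto
  next
    case False
    obtain x \<mu> where x: "x \<in> S" "norm x = 1" "f x = \<mu> *\<^sub>R x"
      using selfadjoint_eigenvector_exists[OF f less.prems sa False] .
    define S' where "S' = S \<inter> {y. x \<bullet> y = 0}"
    have xx: "x \<bullet> x = 1" using x(2) by (simp add: norm_eq_1)
    have S': "subspace S'"
      unfolding S'_def by (intro subspace_inter less.prems(1) subspace_hyperplane)
    have "x \<bullet> f y = 0" if "x \<bullet> y = 0" for y
      using that x(3) by (simp add: sa[symmetric])
    hence inv': "f ` S' \<subseteq> S'" using less.prems(2) by (auto simp: S'_def)
    have "x \<notin> S'" "S' \<subseteq> S" using xx by (auto simp: S'_def)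
    hence "S' \<subset> S" using x(1) by blast
    hence "dim S' < dim S"
      using S' less.prems(1) by (metis dim_psubset span_eq_iff)
    from less.hyps[OF this S' inv'] obtain B where B: "finite B" "B \<subseteq> S'" "span B = S'"
      "pairwise orthogonal B" "\<forall>v\<in>B. norm v = 1 \<and> (\<exists>\<mu>. f v = \<mu> *\<^sub>R v)" by blast
    have "span (insert x B) = S"
    proof
      have "insert x B \<subseteq> S" using x(1) B(2) \<open>S' \<subset> S\<close> by blast
      thus "span (insert x B) \<subseteq> S" using less.prems(1) by (rule span_minimal)
      show "S \<subseteq> span (insert x B)"
      proof
        fix y assume y: "y \<in> S"
        have "y - (x \<bullet> y) *\<^sub>R x \<in> S'"
          using y x(1) less.prems(1) xx
          by (auto simp: S'_def inner_diff_right intro!: subspace_diff subspace_scale)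
        thus "y \<in> span (insert x B)" using B(3) span_breakdown_eq by blast
      qed
    qed
    moreover have "pairwise orthogonal (insert x B)"
      using B(2,4) by (auto simp: pairwise_insert S'_def orthogonal_def inner_commute)
    ultimately show ?thesis
      using B x \<open>S' \<subset> S\<close> by (intro exI[of _ "insert x B"]) blast
  qed
qed

lemma orthonormal_basis_expansion:
  fixes B :: "'a::euclidean_space set"
  assumes "finite B" "span B = UNIV" "pairwise orthogonal B" "\<forall>v\<in>B. norm v = 1"
  shows "x = (\<Sum>v\<in>B. (x \<bullet> v) *\<^sub>R v)"
proof -
  define z where "z = x - (\<Sum>v\<in>B. (x \<bullet> v) *\<^sub>R v)"
  have "z \<bullet> w = 0" if w: "w \<in> B" for w
  proof -
    have "(\<Sum>v\<in>B. (x \<bullet> v) * (v \<bullet> w)) = (\<Sum>v\<in>B. if v = w then x \<bullet> w else 0)"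
      using assms(3,4) w
      by (intro sum.cong) (auto simp: pairwise_def orthogonal_def norm_eq_1)
    thus ?thesis using assms(1) w by (simp add: z_def inner_diff_left inner_sum_left)
  qed
  hence "orthogonal z z"
    using orthogonal_to_span[of z B z] assms(2) by (simp add: orthogonal_def)
  thus ?thesis by (simp add: z_def orthogonal_self)
qed

lemma orthonormal_basis_parseval:
  fixes B :: "'a::euclidean_space set"
  assumes "finite B" "span B = UNIV" "pairwise orthogonal B" "\<forall>v\<in>B. norm v = 1"
  shows "x \<bullet> y = (\<Sum>v\<in>B. (x \<bullet> v) * (y \<bullet> v))"
proof -
  have "x \<bullet> y = (\<Sum>v\<in>B. (x \<bullet> v) *\<^sub>R v) \<bullet> y"
    using orthonormal_basis_expansion[OF assms] by simp
  also have "\<dots> = (\<Sum>v\<in>B. (x \<bullet> v) * (y \<bullet> v))"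
    by (simp add: inner_sum_left inner_commute[of y])
  finally show ?thesis .
qed

lemma inner_matrix_vector_right:
  fixes A :: "real^'n^'m"
  shows "(A *v x) \<bullet> y = x \<bullet> (transpose A *v y)"
  by (metis dot_lmul_matrix inner_commute transpose_matrix_vector)

section \<open>Singular bases, the nuclear norm and the spectral norm\<close>

text \<open>
  A full system of right singular vectors; the image lengths \<open>norm (A *v v)\<close> are then the singular
  values counted with multiplicity, zeros included. All facts about the nuclear and the spectral
  norm are read off such a basis.
\<close>

definition singular_basis :: "real^'n^'m \<Rightarrow> (real^'n) set \<Rightarrow> bool" where
  "singular_basis A B \<longleftrightarrow> finite B \<and> span B = UNIV \<and> pairwise orthogonal B \<and>
     (\<forall>v\<in>B. norm v = 1 \<and> v \<in> singular_space A (norm (A *v v)))"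

lemma singular_basis_exists:
  fixes A :: "real^'n^'m"
  obtains B where "singular_basis A B"
proof -
  let ?f = "\<lambda>x. (transpose A ** A) *v x"
  have sa: "?f x \<bullet> y = x \<bullet> ?f y" for x y
    by (simp add: inner_matrix_vector_right matrix_transpose_mul)
  obtain B where B: "finite B" "span B = UNIV" "pairwise orthogonal B"
    "\<forall>v\<in>B. norm v = 1" "\<And>v. v \<in> B \<Longrightarrow> \<exists>\<mu>. ?f v = \<mu> *\<^sub>R v"
    using selfadjoint_orthonormal_eigenbasis[of ?f UNIV] sa by (auto simp: matrix_vector_mul_linear)
  have "v \<in> singular_space A (norm (A *v v))" if v: "v \<in> B" for v
  proof -
    obtain \<mu> where \<mu>: "?f v = \<mu> *\<^sub>R v" using B(5)[OF v] by blast
    have "(norm (A *v v))\<^sup>2 = v \<bullet> ?f v"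
      by (simp add: power2_norm_eq_inner inner_matrix_vector_right matrix_vector_mul_assoc)
    hence "(norm (A *v v))\<^sup>2 = \<mu>" using B(4) v by (simp add: \<mu> norm_eq_1)
    thus ?thesis using \<mu> by (simp add: singular_space_def)
  qed
  hence "singular_basis A B" using B(1-4) by (simp add: singular_basis_def)
  thus thesis by (rule that)
qed

lemma singular_basis_images_orthogonal:
  assumes "singular_basis A B" "v \<in> B" "w \<in> B" "v \<noteq> w"
  shows "(A *v v) \<bullet> (A *v w) = 0"
proof -
  have "(A *v v) \<bullet> (A *v w) = v \<bullet> ((transpose A ** A) *v w)"
    by (simp add: inner_matrix_vector_right matrix_vector_mul_assoc)
  also have "\<dots> = (norm (A *v w))\<^sup>2 * (v \<bullet> w)"
    using assms by (simp add: singular_basis_def singular_space_def)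
  also have "v \<bullet> w = 0"
    using assms by (auto simp: singular_basis_def pairwise_def orthogonal_def)
  finally show ?thesis by simp
qed

lemma singular_space_orthogonal:
  assumes "v \<in> singular_space A \<sigma>" "w \<in> singular_space A \<tau>" "\<sigma> \<ge> 0" "\<tau> \<ge> 0" "\<sigma> \<noteq> \<tau>"
  shows "v \<bullet> w = 0"
proof -
  have "\<sigma>\<^sup>2 * (v \<bullet> w) = ((transpose A ** A) *v v) \<bullet> w"
    using assms(1) by (simp add: singular_space_def)
  also have "\<dots> = v \<bullet> ((transpose A ** A) *v w)"
    by (simp add: inner_matrix_vector_right matrix_transpose_mul)
  also have "\<dots> = \<tau>\<^sup>2 * (v \<bullet> w)" using assms(2) by (simp add: singular_space_def)
  finally show ?thesis using assms(3-5) by (simp add: power2_eq_iff_nonneg)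
qed

lemma singular_space_eq_span:
  assumes B: "singular_basis A B" and \<sigma>: "\<sigma> \<ge> 0"
  shows "singular_space A \<sigma> = span {v \<in> B. norm (A *v v) = \<sigma>}"
proof
  have "subspace (singular_space A \<sigma>)"
    by (auto simp: subspace_def singular_space_def matrix_vector_right_distrib
        matrix_vector_mult_scaleR scaleR_add_right)
  thus "span {v \<in> B. norm (A *v v) = \<sigma>} \<subseteq> singular_space A \<sigma>"
    using B by (intro span_minimal) (auto simp: singular_basis_def)
  show "singular_space A \<sigma> \<subseteq> span {v \<in> B. norm (A *v v) = \<sigma>}"
  proof
    fix x assume x: "x \<in> singular_space A \<sigma>"
    have "x = (\<Sum>v\<in>B. (x \<bullet> v) *\<^sub>R v)"
      using B by (intro orthonormal_basis_expansion) (auto simp: singular_basis_def)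
    also have "\<dots> \<in> span {v \<in> B. norm (A *v v) = \<sigma>}"
    proof (rule span_sum)
      fix v assume v: "v \<in> B"
      show "(x \<bullet> v) *\<^sub>R v \<in> span {v \<in> B. norm (A *v v) = \<sigma>}"
      proof (cases "norm (A *v v) = \<sigma>")
        case True thus ?thesis using v by (simp add: span_base span_scale)
      next
        case False
        have "x \<bullet> v = 0"
          using singular_space_orthogonal[OF x _ \<sigma>, of v "norm (A *v v)"] False B v
          by (auto simp: singular_basis_def)
        thus ?thesis by (simp add: span_zero)
      qed
    qed
    finally show "x \<in> span {v \<in> B. norm (A *v v) = \<sigma>}" .
  qed
qed

lemma singular_values_eq_image:
  assumes B: "singular_basis A B"
  shows "singular_values A = (\<lambda>v. norm (A *v v)) ` B"
proof
  show "(\<lambda>v. norm (A *v v)) ` B \<subseteq> singular_values A"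
  proof safe
    fix v assume "v \<in> B"
    hence "v \<in> singular_space A (norm (A *v v))" "v \<noteq> 0"
      using B by (auto simp: singular_basis_def)
    thus "norm (A *v v) \<in> singular_values A" by (auto simp: singular_values_def)
  qed
  show "singular_values A \<subseteq> (\<lambda>v. norm (A *v v)) ` B"
  proof
    fix \<sigma> assume "\<sigma> \<in> singular_values A"
    then obtain x where x: "\<sigma> \<ge> 0" "x \<in> singular_space A \<sigma>" "x \<noteq> 0"
      by (auto simp: singular_values_def)
    have "x \<in> span {v \<in> B. norm (A *v v) = \<sigma>}"
      using x singular_space_eq_span[OF B] by blast
    hence "{v \<in> B. norm (A *v v) = \<sigma>} \<noteq> {}"
      using x(3) by (metis singletonD span_empty)
    thus "\<sigma> \<in> (\<lambda>v. norm (A *v v)) ` B" by blast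
  qed
qed

text \<open>
  Grouping the basis by singular value turns each multiplicity \<open>dim (singular_space A \<sigma>)\<close> into
  the size of a group, since the group is an orthogonal basis of that space.
\<close>

lemma nuclear_norm_eq_sum:
  assumes B: "singular_basis A B"
  shows "nuclear_norm A = (\<Sum>v\<in>B. norm (A *v v))"
proof -
  let ?g = "\<lambda>v. norm (A *v v)"
  have fin: "finite B" using B by (simp add: singular_basis_def)
  have d: "dim (singular_space A \<sigma>) = card {v \<in> B. ?g v = \<sigma>}" if "\<sigma> \<ge> 0" for \<sigma>
  proof -
    have "pairwise orthogonal {v \<in> B. ?g v = \<sigma>}" "0 \<notin> {v \<in> B. ?g v = \<sigma>}"
      using B by (auto simp: singular_basis_def pairwise_def)
    hence "independent {v \<in> B. ?g v = \<sigma>}" by (rule pairwise_orthogonal_independent)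
    thus ?thesis by (simp add: singular_space_eq_span[OF B that] dim_eq_card_independent)
  qed
  have "nuclear_norm A = (\<Sum>\<sigma>\<in>?g ` B. \<Sum>v\<in>{v \<in> B. ?g v = \<sigma>}. ?g v)"
    unfolding nuclear_norm_def singular_values_eq_image[OF B]
    by (intro sum.cong) (auto simp: d)
  also have "\<dots> = (\<Sum>v\<in>B. ?g v)"
    using fin by (intro sum.group) auto
  finally show ?thesis .
qed

text \<open>
  The images of distinct basis vectors are orthogonal, so this is Pythagoras for
  \<open>A *v x\<close>.
\<close>

lemma norm_matrix_vector_singular_basis:
  assumes B: "singular_basis A B"
  shows "(norm (A *v x))\<^sup>2 = (\<Sum>v\<in>B. (x \<bullet> v)\<^sup>2 * (norm (A *v v))\<^sup>2)"
proof -
  have *: "finite B" "span B = UNIV" "pairwise orthogonal B" "\<forall>v\<in>B. norm v = 1"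
    using B by (auto simp: singular_basis_def)
  have "(norm (A *v x))\<^sup>2 = x \<bullet> ((transpose A ** A) *v x)"
    by (simp add: power2_norm_eq_inner inner_matrix_vector_right matrix_vector_mul_assoc)
  also have "\<dots> = (\<Sum>v\<in>B. (x \<bullet> v) * (((transpose A ** A) *v x) \<bullet> v))"
    by (rule orthonormal_basis_parseval[OF *])
  also have "\<dots> = (\<Sum>v\<in>B. (x \<bullet> v) * (x \<bullet> ((transpose A ** A) *v v)))"
    by (simp add: inner_matrix_vector_right matrix_transpose_mul)
  also have "\<dots> = (\<Sum>v\<in>B. (x \<bullet> v)\<^sup>2 * (norm (A *v v))\<^sup>2)"
    using B by (intro sum.cong)
      (auto simp: singular_basis_def singular_space_def power2_eq_square algebra_simps)
  finally show ?thesis .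
qed

lemma norm_matrix_vector_le_spectral_norm:
  fixes A :: "real^'n^'m"
  shows "norm (A *v x) \<le> spectral_norm A * norm x"
proof -
  obtain B where B: "singular_basis A B" by (rule singular_basis_exists)
  have *: "finite B" "span B = UNIV" "pairwise orthogonal B" "\<forall>v\<in>B. norm v = 1"
    using B by (auto simp: singular_basis_def)
  have le: "norm (A *v v) \<le> spectral_norm A" if "v \<in> B" for v
    using * that by (simp add: spectral_norm_def singular_values_eq_image[OF B])
  have "B \<noteq> {}" using *(2) by (metis UNIV_I singletonD span_empty axis_eq_0_iff zero_neq_one)
  hence s0: "spectral_norm A \<ge> 0" using le norm_ge_zero order_trans by blast
  have "(norm (A *v x))\<^sup>2 = (\<Sum>v\<in>B. (x \<bullet> v)\<^sup>2 * (norm (A *v v))\<^sup>2)"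
    by (rule norm_matrix_vector_singular_basis[OF B])
  also have "\<dots> \<le> (\<Sum>v\<in>B. (x \<bullet> v)\<^sup>2 * (spectral_norm A)\<^sup>2)"
    by (intro sum_mono mult_left_mono power_mono le) auto
  also have "\<dots> = (\<Sum>v\<in>B. (x \<bullet> v) * (x \<bullet> v)) * (spectral_norm A)\<^sup>2"
    by (simp add: sum_distrib_right power2_eq_square)
  also have "\<dots> = (spectral_norm A * norm x)\<^sup>2"
    using orthonormal_basis_parseval[OF *, of x x]
    by (simp add: power_mult_distrib power2_norm_eq_inner)
  finally show ?thesis by (rule power2_le_imp_le) (use s0 in simp)
qed

lemma inner_matrix_eq_sum_basis:
  fixes M N :: "real^'n^'m"
  assumes "finite B" "span B = UNIV" "pairwise orthogonal B" "\<forall>v\<in>B. norm v = 1"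
  shows "M \<bullet> N = (\<Sum>v\<in>B. (M *v v) \<bullet> (N *v v))"
proof -
  have "M \<bullet> N = (\<Sum>i\<in>UNIV. \<Sum>v\<in>B. (M $ i \<bullet> v) * (N $ i \<bullet> v))"
    unfolding inner_vec_def[of M N] by (intro sum.cong refl orthonormal_basis_parseval[OF assms])
  also have "\<dots> = (\<Sum>v\<in>B. \<Sum>i\<in>UNIV. (M $ i \<bullet> v) * (N $ i \<bullet> v))" by (rule sum.swap)
  finally show ?thesis by (simp add: inner_vec_def[of "_ *v _"] matrix_vector_mul_component)
qed

text \<open>
  One half of the duality between spectral and nuclear norm: evaluate the trace inner product in
  a singular basis of \<open>N\<close> and apply Cauchy--Schwarz termwise.
\<close>

lemma inner_le_nuclear_norm:
  fixes Z N :: "real^'n^'m"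
  assumes Z: "\<And>x. norm (Z *v x) \<le> c * norm x"
  shows "Z \<bullet> N \<le> c * nuclear_norm N"
proof -
  obtain B where B: "singular_basis N B" by (rule singular_basis_exists)
  have *: "finite B" "span B = UNIV" "pairwise orthogonal B" "\<forall>v\<in>B. norm v = 1"
    using B by (auto simp: singular_basis_def)
  have "Z \<bullet> N = (\<Sum>v\<in>B. (Z *v v) \<bullet> (N *v v))" by (rule inner_matrix_eq_sum_basis[OF *])
  also have "\<dots> \<le> (\<Sum>v\<in>B. c * norm (N *v v))"
  proof (rule sum_mono)
    fix v assume "v \<in> B"
    hence "norm (Z *v v) \<le> c" using Z[of v] *(4) by simp
    hence "norm (Z *v v) * norm (N *v v) \<le> c * norm (N *v v)" by (intro mult_right_mono) auto
    thus "(Z *v v) \<bullet> (N *v v) \<le> c * norm (N *v v)"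
      using norm_cauchy_schwarz order_trans by blast
  qed
  finally show ?thesis by (simp add: nuclear_norm_eq_sum[OF B] sum_distrib_left)
qed

text \<open>
  The other half of the duality: the maximising contraction sends each right singular vector of
  \<open>N\<close> to the corresponding left one. Singular vectors with value zero are sent to zero, which is
  what the convention \<open>inverse 0 = 0\<close> produces.
\<close>

lemma nuclear_norm_attained:
  fixes N :: "real^'n^'m"
  obtains Z :: "real^'n^'m" where "\<And>x. norm (Z *v x) \<le> norm x" "nuclear_norm N = Z \<bullet> N"
proof -
  obtain B where B: "singular_basis N B" by (rule singular_basis_exists)
  have *: "finite B" "span B = UNIV" "pairwise orthogonal B" "\<forall>v\<in>B. norm v = 1"
    using B by (auto simp: singular_basis_def)
  define h where "h x = (\<Sum>v\<in>B. (x \<bullet> v) *\<^sub>R ((N *v v) /\<^sub>R norm (N *v v)))" for x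
  have lin: "linear h"
    unfolding h_def by (rule linear_compose_sum)
      (simp add: linear_iff inner_add_left algebra_simps)
  have Z: "matrix h *v x = h x" for x using lin by (simp add: matrix_works)
  have hv: "h w = (N *v w) /\<^sub>R norm (N *v w)" if w: "w \<in> B" for w
  proof -
    have "w \<bullet> v = (if v = w then 1 else 0)" if "v \<in> B" for v
      using *(3,4) w that by (auto simp: pairwise_def orthogonal_def norm_eq_1)
    hence "h w = (\<Sum>v\<in>B. if v = w then (N *v w) /\<^sub>R norm (N *v w) else 0)"
      unfolding h_def by (intro sum.cong) auto
    thus ?thesis using *(1) w by simp
  qed
  have "norm (h x) \<le> norm x" for x
  proof -
    have "pairwise (\<lambda>v w. orthogonal ((x \<bullet> v) *\<^sub>R ((N *v v) /\<^sub>R norm (N *v v)))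
        ((x \<bullet> w) *\<^sub>R ((N *v w) /\<^sub>R norm (N *v w)))) B"
      unfolding pairwise_def orthogonal_def
      by (simp add: singular_basis_images_orthogonal[OF B])
    hence "(norm (h x))\<^sup>2 = (\<Sum>v\<in>B. (norm ((x \<bullet> v) *\<^sub>R ((N *v v) /\<^sub>R norm (N *v v))))\<^sup>2)"
      unfolding h_def by (rule norm_sum_Pythagorean[OF *(1)])
    also have "\<dots> \<le> (\<Sum>v\<in>B. (x \<bullet> v)\<^sup>2)"
    proof (rule sum_mono)
      fix v
      have "norm ((x \<bullet> v) *\<^sub>R ((N *v v) /\<^sub>R norm (N *v v))) \<le> \<bar>x \<bullet> v\<bar>"
        by (cases "N *v v = 0") (simp_all add: abs_mult mult.assoc)
      from power_mono[OF this norm_ge_zero, of 2]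
      show "(norm ((x \<bullet> v) *\<^sub>R ((N *v v) /\<^sub>R norm (N *v v))))\<^sup>2 \<le> (x \<bullet> v)\<^sup>2" by simp
    qed
    also have "\<dots> = (norm x)\<^sup>2"
      using orthonormal_basis_parseval[OF *, of x x] by (simp add: power2_norm_eq_inner power2_eq_square[of "_ \<bullet> _"])
    finally show ?thesis by (rule power2_le_imp_le) simp
  qed
  moreover have "nuclear_norm N = matrix h \<bullet> N"
    unfolding nuclear_norm_eq_sum[OF B] inner_matrix_eq_sum_basis[OF *, of "matrix h" N]
    by (intro sum.cong refl) (auto simp: Z hv power2_norm_eq_inner[symmetric] power2_eq_square, metis left_inverse norm_eq_zero)
  ultimately show thesis using that[of "matrix h"] Z by simp
qed

text \<open>
  By the duality, the nuclear norm is a maximum of linear functions.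
\<close>

lemma nuclear_norm_convex:
  fixes M N :: "real^'n^'m"
  assumes "0 \<le> t" "t \<le> 1"
  shows "nuclear_norm ((1 - t) *\<^sub>R M + t *\<^sub>R N) \<le> (1 - t) * nuclear_norm M + t * nuclear_norm N"
proof -
  obtain Z :: "real^'n^'m" where Z: "\<And>x. norm (Z *v x) \<le> norm x"
    and eq: "nuclear_norm ((1 - t) *\<^sub>R M + t *\<^sub>R N) = Z \<bullet> ((1 - t) *\<^sub>R M + t *\<^sub>R N)"
    using nuclear_norm_attained[of "(1 - t) *\<^sub>R M + t *\<^sub>R N"] by blast
  have "Z \<bullet> K \<le> nuclear_norm K" for K using inner_le_nuclear_norm[of Z 1 K] Z by simp
  thus ?thesis using assms by (simp add: eq inner_add_right add_mono mult_left_mono)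
qed

section \<open>Frobenius inner product and orthonormal columns\<close>

text \<open>
  The library rewrites \<open>transpose A *v x\<close> to \<open>x v* A\<close>, which would break up products such as
  \<open>U *v (transpose U *v x)\<close> that the arguments below treat as projections.
\<close>

declare transpose_matrix_vector [simp del]

lemma inner_matrix_mult_left:
  fixes A :: "real^'k^'m" and X :: "real^'n^'k" and C :: "real^'n^'m"
  shows "(A ** X) \<bullet> C = X \<bullet> (transpose A ** C)"
proof -
  have "(A ** X) \<bullet> C = (\<Sum>i\<in>UNIV. \<Sum>j\<in>UNIV. \<Sum>k\<in>UNIV. A$i$k * X$k$j * C$i$j)"
    by (simp add: inner_vec_def matrix_matrix_mult_def sum_distrib_right)
  also have "\<dots> = (\<Sum>i\<in>UNIV. \<Sum>k\<in>UNIV. \<Sum>j\<in>UNIV. A$i$k * X$k$j * C$i$j)"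
    by (intro sum.cong refl sum.swap)
  also have "\<dots> = (\<Sum>k\<in>UNIV. \<Sum>i\<in>UNIV. \<Sum>j\<in>UNIV. A$i$k * X$k$j * C$i$j)"
    by (rule sum.swap)
  also have "\<dots> = (\<Sum>k\<in>UNIV. \<Sum>j\<in>UNIV. \<Sum>i\<in>UNIV. A$i$k * X$k$j * C$i$j)"
    by (intro sum.cong refl sum.swap)
  also have "\<dots> = X \<bullet> (transpose A ** C)"
    by (simp add: inner_vec_def matrix_matrix_mult_def transpose_def sum_distrib_left mult_ac)
  finally show ?thesis .
qed

lemma inner_transpose_transpose:
  fixes A C :: "real^'n^'m"
  shows "transpose A \<bullet> transpose C = A \<bullet> C"
proof -
  have "transpose A \<bullet> transpose C = (\<Sum>j\<in>UNIV. \<Sum>i\<in>UNIV. A$i$j * C$i$j)"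
    by (simp add: inner_vec_def transpose_def)
  also have "\<dots> = (\<Sum>i\<in>UNIV. \<Sum>j\<in>UNIV. A$i$j * C$i$j)" by (rule sum.swap)
  finally show ?thesis by (simp add: inner_vec_def)
qed

lemma norm_transpose: "norm (transpose (A :: real^'n^'m)) = norm A"
  by (simp add: norm_eq_sqrt_inner inner_transpose_transpose)

lemma inner_matrix_mult_right:
  fixes A :: "real^'k^'m" and X :: "real^'n^'k" and C :: "real^'n^'m"
  shows "(A ** X) \<bullet> C = A \<bullet> (C ** transpose X)"
proof -
  have "(A ** X) \<bullet> C = (transpose X ** transpose A) \<bullet> transpose C"
    by (metis inner_transpose_transpose matrix_transpose_mul)
  also have "\<dots> = transpose A \<bullet> transpose (C ** transpose X)"
    by (simp add: inner_matrix_mult_left matrix_transpose_mul)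
  finally show ?thesis by (simp add: inner_transpose_transpose)
qed

lemma norm_matrix_eq_sum_columns:
  fixes A :: "real^'n^'m"
  shows "(norm A)\<^sup>2 = (\<Sum>j\<in>UNIV. (norm (column j A))\<^sup>2)"
proof -
  have "(norm A)\<^sup>2 = transpose A \<bullet> transpose A"
    by (simp add: power2_norm_eq_inner inner_transpose_transpose)
  thus ?thesis
    by (simp add: inner_vec_def transpose_def column_def power2_norm_eq_inner)
qed

lemma column_matrix_mult: "column j (A ** X) = (A :: real^'k^'m) *v column j X"
  by (simp add: vec_eq_iff column_def matrix_matrix_mult_def matrix_vector_mult_def)

lemma matrix_mult_diff_left: "(A :: real^'k^'m) ** (X - Y) = A ** X - A ** Y"
  by (simp add: vec_eq_iff matrix_matrix_mult_def sum_subtractf right_diff_distrib)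

lemma matrix_mult_diff_right: "(X - Y) ** (A :: real^'n^'k) = X ** A - Y ** A"
  by (simp add: vec_eq_iff matrix_matrix_mult_def sum_subtractf left_diff_distrib)

lemma matrix_mult_add_right: "(X + Y) ** (A :: real^'n^'k) = X ** A + Y ** A"
  by (simp add: vec_eq_iff matrix_matrix_mult_def sum.distrib distrib_right)

lemma matrix_mult_scaleR_left: "(A :: real^'k^'m) ** (c *\<^sub>R X) = c *\<^sub>R (A ** X)"
  by (simp add: vec_eq_iff matrix_matrix_mult_def sum_distrib_left mult_ac)

lemma matrix_mult_scaleR_right: "(c *\<^sub>R X) ** (A :: real^'n^'k) = c *\<^sub>R (X ** A)"
  by (simp add: vec_eq_iff matrix_matrix_mult_def sum_distrib_left mult_ac)

lemma norm_contraction_mult_le: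
  fixes Z :: "real^'k^'m" and X :: "real^'n^'k"
  assumes "\<And>x. norm (Z *v x) \<le> norm x"
  shows "norm (Z ** X) \<le> norm X"
proof (rule power2_le_imp_le)
  show "(norm (Z ** X))\<^sup>2 \<le> (norm X)\<^sup>2"
    unfolding norm_matrix_eq_sum_columns column_matrix_mult
    by (intro sum_mono power_mono assms norm_ge_zero)
qed simp

text \<open>
  With \<open>y = Z\<^sup>T x\<close>, the number \<open>\<parallel>y\<parallel>\<^sup>2 = \<langle>Z y, x\<rangle>\<close> is at most \<open>\<parallel>y\<parallel> \<parallel>x\<parallel>\<close>.
\<close>

lemma transpose_contraction:
  fixes Z :: "real^'n^'m"
  assumes Z: "\<And>x. norm (Z *v x) \<le> norm x"
  shows "norm (transpose Z *v x) \<le> norm x"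
proof -
  let ?y = "transpose Z *v x"
  have "(norm ?y)\<^sup>2 = (Z *v ?y) \<bullet> x"
    by (simp add: power2_norm_eq_inner inner_matrix_vector_right)
  also have "\<dots> \<le> norm (Z *v ?y) * norm x" by (rule norm_cauchy_schwarz)
  also have "\<dots> \<le> norm ?y * norm x" by (intro mult_right_mono Z) simp
  finally have "norm ?y * norm ?y \<le> norm ?y * norm x" by (simp add: power2_eq_square)
  thus ?thesis by (cases "?y = 0") auto
qed

lemma norm_orthonormal_columns_vector:
  fixes U :: "real^'r^'m"
  assumes "transpose U ** U = mat 1"
  shows "norm (U *v y) = norm y"
  by (simp add: norm_eq_sqrt_inner inner_matrix_vector_right matrix_vector_mul_assoc assms)

lemma orthonormal_columns_cancel:
  fixes U :: "real^'r^'m"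
  assumes "transpose U ** U = mat 1"
  shows "transpose U *v (U *v y) = y"
  by (simp add: matrix_vector_mul_assoc assms)

lemma norm_orthonormal_columns_split:
  fixes U :: "real^'r^'m"
  assumes "transpose U ** U = mat 1"
  shows "(norm x)\<^sup>2 = (norm (transpose U *v x))\<^sup>2 + (norm (x - U *v (transpose U *v x)))\<^sup>2"
proof -
  let ?a = "transpose U *v x"
  have 1: "x \<bullet> (U *v ?a) = ?a \<bullet> ?a"
    using inner_matrix_vector_right[of U ?a x] by (simp add: inner_commute)
  have 2: "(U *v ?a) \<bullet> (U *v ?a) = ?a \<bullet> ?a"
    by (simp add: inner_matrix_vector_right[of U] orthonormal_columns_cancel[OF assms])
  show ?thesis
    by (simp add: power2_norm_eq_inner inner_diff_left inner_diff_right 1 2 inner_commute[of "U *v ?a" x])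
qed

lemma norm_orthonormal_columns_sq:
  fixes U :: "real^'r^'m"
  assumes "transpose U ** U = mat 1"
  shows "(norm U)\<^sup>2 = real CARD('r)"
proof -
  have "column j U = U *v axis j 1" for j
    by (simp add: matrix_vector_mult_basis)
  thus ?thesis
    by (simp add: norm_matrix_eq_sum_columns norm_orthonormal_columns_vector[OF assms])
qed

section \<open>The tangent space and its projection\<close>

text \<open>
  Grouping the products around the projections \<open>U U\<^sup>T\<close> and \<open>V V\<^sup>T\<close> makes the later facts about
  \<open>proj_T\<close> consequences of their idempotence and symmetry.
\<close>

lemma proj_T_eq_column_projections:
  "proj_T U V M = (U ** transpose U) ** M + M ** (V ** transpose V)
     - (U ** transpose U) ** M ** (V ** transpose V)"
  by (simp add: proj_T_def matrix_mul_assoc)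

lemma proj_T_linear: "linear (proj_T U V)"
  by (rule linearI)
    (simp_all add: proj_T_eq_column_projections matrix_add_ldistrib matrix_mult_add_right matrix_mult_scaleR_left
      matrix_mult_scaleR_right algebra_simps)

lemma orthonormal_columns_idempotent:
  fixes U :: "real^'r^'m"
  assumes "transpose U ** U = mat 1"
  shows "(U ** transpose U) ** (U ** transpose U) = U ** transpose U"
  by (metis assms matrix_mul_assoc matrix_mul_rid)

lemma proj_T_in_tangent_space: "proj_T U V M \<in> tangent_space U V"
proof -
  have "proj_T U V M = U ** transpose U ** M + (M - U ** transpose U ** M) ** V ** transpose V"
    by (simp add: proj_T_def matrix_mult_diff_right)
  thus ?thesis unfolding tangent_space_def by blast
qed

lemma proj_T_eq_self:
  fixes U :: "real^'r^'m" and V :: "real^'r^'n"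
  assumes U: "transpose U ** U = mat 1" and V: "transpose V ** V = mat 1"
    and "M \<in> tangent_space U V"
  shows "proj_T U V M = M"
proof -
  define E where "E = U ** transpose U"
  define G where "G = V ** transpose V"
  have EE: "E ** E = E" and GG: "G ** G = G"
    using U V by (simp_all add: E_def G_def orthonormal_columns_idempotent)
  have EE': "E ** (E ** X) = E ** X" for X :: "real^'n^'m" by (simp add: matrix_mul_assoc EE)
  obtain A C where M: "M = E ** A + C ** G"
    using assms(3) by (auto simp: tangent_space_def E_def G_def matrix_mul_assoc)
  show ?thesis
    unfolding proj_T_eq_column_projections E_def[symmetric] G_def[symmetric] M
    by (simp add: matrix_add_ldistrib matrix_mult_add_right matrix_mul_assoc[symmetric] EE' GG)
qed

lemma tangent_space_iff:
  fixes U :: "real^'r^'m" and V :: "real^'r^'n"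
  assumes "transpose U ** U = mat 1" "transpose V ** V = mat 1"
  shows "M \<in> tangent_space U V \<longleftrightarrow> proj_T U V M = M"
  using proj_T_eq_self[OF assms] proj_T_in_tangent_space by metis

lemma proj_T_selfadjoint: "proj_T U V M \<bullet> N = M \<bullet> proj_T U V N"
proof -
  define E where "E = U ** transpose U"
  define G where "G = V ** transpose V"
  have tr: "transpose E = E" "transpose G = G"
    by (simp_all add: E_def G_def matrix_transpose_mul)
  show ?thesis
    unfolding proj_T_eq_column_projections E_def[symmetric] G_def[symmetric]
    by (simp add: inner_add_left inner_add_right inner_diff_left inner_diff_right
        inner_matrix_mult_left[of E M] inner_matrix_mult_right[of M G]
        inner_matrix_mult_right[of "E ** M" G] inner_matrix_mult_left[of E M "N ** G"] tr matrix_mul_assoc)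
qed

text \<open>
  The complementary projection is the two-sided compression
  \<open>M \<mapsto> (I - U U\<^sup>T) M (I - V V\<^sup>T)\<close>.
\<close>

lemma compl_proj_T_mult_vector:
  fixes U :: "real^'r^'m" and V :: "real^'r^'n"
  shows "(M - proj_T U V M) *v x = (let z = M *v (x - V *v (transpose V *v x)) in z - U *v (transpose U *v z))"
  by (simp add: Let_def proj_T_eq_column_projections matrix_vector_mult_diff_distrib matrix_vector_mult_diff_rdistrib
      matrix_vector_mult_add_rdistrib matrix_vector_mul_assoc matrix_mul_assoc)

text \<open>
  The two summands act on orthogonal parts of \<open>x\<close> (inside and outside the column space of \<open>V\<close>)
  and have orthogonal ranges (inside and outside that of \<open>U\<close>), so their bounds combine without
  loss. Applied with the residual of the oracle as complementary part, this certifies the spectral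
  bound on which the duality argument rests.
\<close>

lemma norm_certificate_mult_vector_le:
  fixes U :: "real^'r^'m" and V :: "real^'r^'n"
  assumes U: "transpose U ** U = mat 1" and V: "transpose V ** V = mat 1"
    and c: "c \<ge> 0" and M: "\<And>x. norm (M *v x) \<le> c * norm x"
  shows "norm ((c *\<^sub>R (U ** transpose V) + (M - proj_T U V M)) *v x) \<le> c * norm x"
proof -
  define p where "p = x - V *v (transpose V *v x)"
  define q where "q = M *v p - U *v (transpose U *v (M *v p))"
  define h where "h = U *v (c *\<^sub>R (transpose V *v x))"
  have eq: "(c *\<^sub>R (U ** transpose V) + (M - proj_T U V M)) *v x = h + q"
    by (simp add: h_def q_def p_def matrix_vector_mult_add_rdistrib compl_proj_T_mult_vector Let_def
        matrix_vector_mul_assoc matrix_mul_assoc matrix_vector_mult_scaleR scaleR_matrix_vector_assoc[symmetric])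
  have "transpose U *v q = 0"
    by (simp add: q_def matrix_vector_mult_diff_distrib orthonormal_columns_cancel[OF U])
  hence "orthogonal h q" by (simp add: orthogonal_def h_def inner_matrix_vector_right)
  hence "(norm (h + q))\<^sup>2 = (norm h)\<^sup>2 + (norm q)\<^sup>2" by (rule norm_add_Pythagorean)
  also have "(norm h)\<^sup>2 = c\<^sup>2 * (norm (transpose V *v x))\<^sup>2"
    by (simp add: h_def norm_orthonormal_columns_vector[OF U] power_mult_distrib)
  also have "(norm q)\<^sup>2 \<le> c\<^sup>2 * (norm p)\<^sup>2"
  proof -
    have "(norm q)\<^sup>2 \<le> (norm (M *v p))\<^sup>2"
      using norm_orthonormal_columns_split[OF U, of "M *v p"] by (simp add: q_def)
    also have "\<dots> \<le> (c * norm p)\<^sup>2" by (intro power_mono M) simp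
    finally show ?thesis by (simp add: power_mult_distrib)
  qed
  also have "c\<^sup>2 * (norm (transpose V *v x))\<^sup>2 + c\<^sup>2 * (norm p)\<^sup>2 = (c * norm x)\<^sup>2"
    unfolding p_def by (simp add: power_mult_distrib norm_orthonormal_columns_split[OF V, of x] distrib_left)
  finally show ?thesis unfolding eq by (rule power2_le_imp_le) (use c in auto)
qed

section \<open>The subgradient defect of the nuclear norm\<close>

text \<open>
  A contraction whose inner product with \<open>U V\<^sup>T\<close> is close to the maximal value \<open>r\<close> almost maps
  \<open>V\<close> to \<open>U\<close>. The squared distance is linear in the deficit because \<open>\<parallel>Z V\<parallel>\<^sup>2 \<le> r = \<parallel>U\<parallel>\<^sup>2\<close>.
\<close>

lemma contraction_misalignment:
  fixes U :: "real^'r^'m" and V :: "real^'r^'n" and Z :: "real^'n^'m"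
  assumes U: "transpose U ** U = mat 1" and V: "transpose V ** V = mat 1"
    and Z: "\<And>x. norm (Z *v x) \<le> norm x"
  shows "(norm (Z ** V - U))\<^sup>2 \<le> 2 * (real CARD('r) - Z \<bullet> (U ** transpose V))"
proof -
  have "(norm (Z ** V))\<^sup>2 \<le> (norm V)\<^sup>2" by (intro power_mono norm_contraction_mult_le Z) simp
  moreover have "(Z ** V) \<bullet> U = Z \<bullet> (U ** transpose V)" by (rule inner_matrix_mult_right)
  moreover have "(norm (Z ** V - U))\<^sup>2 = (norm (Z ** V))\<^sup>2 - 2 * ((Z ** V) \<bullet> U) + (norm U)\<^sup>2"
    by (simp add: power2_norm_eq_inner inner_diff_left inner_diff_right inner_commute)
  ultimately show ?thesis
    using norm_orthonormal_columns_sq[OF U] norm_orthonormal_columns_sq[OF V] by simp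
qed

text \<open>
  With \<open>K = Z - U V\<^sup>T\<close>, inclusion and exclusion gives
  \<open>\<parallel>P K\<parallel>\<^sup>2 = \<parallel>U\<^sup>T K\<parallel>\<^sup>2 + \<parallel>K V\<parallel>\<^sup>2 - \<parallel>U\<^sup>T K V\<parallel>\<^sup>2\<close>. Both positive terms are misalignments, one
  of \<open>Z\<close> and one of its transpose.
\<close>

lemma norm_proj_T_misalignment:
  fixes U :: "real^'r^'m" and V :: "real^'r^'n" and Z :: "real^'n^'m"
  assumes U: "transpose U ** U = mat 1" and V: "transpose V ** V = mat 1"
    and Z: "\<And>x. norm (Z *v x) \<le> norm x"
  shows "(norm (proj_T U V (Z - U ** transpose V)))\<^sup>2 \<le> 4 * (real CARD('r) - Z \<bullet> (U ** transpose V))"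
proof -
  define K where "K = Z - U ** transpose V"
  have KV: "K ** V = Z ** V - U"
    unfolding K_def by (metis V matrix_mul_assoc matrix_mul_rid matrix_mult_diff_right)
  have tK: "transpose K = transpose Z - V ** transpose U"
    by (simp add: K_def vec_eq_iff transpose_def matrix_matrix_mult_def mult.commute)
  have KU: "transpose K ** U = transpose Z ** U - V"
    unfolding tK by (metis U matrix_mul_assoc matrix_mul_rid matrix_mult_diff_right)
  have "transpose Z \<bullet> (V ** transpose U) = Z \<bullet> (U ** transpose V)"
    using inner_transpose_transpose[of Z "U ** transpose V"] by (simp add: matrix_transpose_mul)
  hence 1: "(norm (transpose K ** U))\<^sup>2 \<le> 2 * (real CARD('r) - Z \<bullet> (U ** transpose V))"
    using contraction_misalignment[OF V U transpose_contraction[OF Z]] by (simp add: KU)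
  have 2: "(norm (K ** V))\<^sup>2 \<le> 2 * (real CARD('r) - Z \<bullet> (U ** transpose V))"
    using contraction_misalignment[OF U V Z] by (simp add: KV)
  have nU: "norm (transpose U ** K) = norm (transpose K ** U)"
    using norm_transpose[of "transpose K ** U"] by (simp add: matrix_transpose_mul)
  have "(norm (proj_T U V K))\<^sup>2 = proj_T U V K \<bullet> K"
    using proj_T_selfadjoint[of U V K "proj_T U V K"] proj_T_eq_self[OF U V proj_T_in_tangent_space]
    by (simp add: power2_norm_eq_inner inner_commute)
  also have "\<dots> = (norm (transpose U ** K))\<^sup>2 + (norm (K ** V))\<^sup>2 - (norm (transpose U ** K ** V))\<^sup>2"
  proof -
    have a: "(U ** transpose U ** K) \<bullet> K = (norm (transpose U ** K))\<^sup>2"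
      by (simp add: power2_norm_eq_inner matrix_mul_assoc[symmetric] inner_matrix_mult_left[of U])
    have b: "(K ** V ** transpose V) \<bullet> K = (norm (K ** V))\<^sup>2"
      by (simp add: power2_norm_eq_inner inner_matrix_mult_right[of "K ** V"])
    have "(U ** transpose U ** K ** V ** transpose V) \<bullet> K = (U ** (transpose U ** K ** V)) \<bullet> (K ** V)"
      by (simp add: inner_matrix_mult_right[of "_ ** V"] matrix_mul_assoc)
    also have "\<dots> = (norm (transpose U ** K ** V))\<^sup>2"
      by (subst inner_matrix_mult_left) (simp add: power2_norm_eq_inner matrix_mul_assoc)
    finally show ?thesis using a b by (simp add: proj_T_def inner_add_left inner_diff_left)
  qed
  also have "\<dots> \<le> 4 * (real CARD('r) - Z \<bullet> (U ** transpose V))"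
    using 1 2 zero_le_power2[of "norm (transpose U ** K ** V)"] unfolding nU by linarith
  finally show ?thesis by (simp add: K_def)
qed

lemma inner_diagonal:
  fixes C :: "real^'r^'r"
  shows "C \<bullet> (\<chi> i j. if i = j then b i else 0) = (\<Sum>i\<in>UNIV. C$i$i * b i)"
proof -
  have "C$i$j * (if i = j then b i else 0) = (if i = j then C$i$i * b i else 0)" for i j by simp
  thus ?thesis by (simp add: inner_vec_def)
qed

lemma contraction_core_diag_le:
  fixes U :: "real^'r^'m" and V :: "real^'r^'n" and Z :: "real^'n^'m"
  assumes U: "transpose U ** U = mat 1" and V: "transpose V ** V = mat 1"
    and Z: "\<And>x. norm (Z *v x) \<le> norm x"
  shows "(transpose U ** Z ** V) $ i $ i \<le> 1"
proof -
  have "(transpose U ** Z ** V) $ i $ i = axis i 1 \<bullet> ((transpose U ** Z ** V) *v axis i 1)"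
    by (simp add: inner_axis' matrix_vector_mult_basis column_def)
  also have "\<dots> = (U *v axis i 1) \<bullet> (Z *v (V *v axis i 1))"
    by (simp add: inner_matrix_vector_right matrix_vector_mul_assoc matrix_mul_assoc)
  also have "\<dots> \<le> norm (U *v axis i 1) * norm (Z *v (V *v axis i 1))"
    by (rule norm_cauchy_schwarz)
  also have "\<dots> \<le> norm (U *v axis i 1) * norm (V *v axis i 1)"
    by (intro mult_left_mono Z) simp
  finally show ?thesis
    by (simp add: norm_orthonormal_columns_vector[OF U] norm_orthonormal_columns_vector[OF V])
qed

text \<open>
  The defect is \<open>\<langle>K, M\<rangle>\<close> with \<open>K = Z - U V\<^sup>T\<close> for the contraction \<open>Z\<close> attaining
  \<open>\<parallel>M\<parallel>\<^sub>N\<close>. Let \<open>t = r - \<langle>Z, U V\<^sup>T\<rangle>\<close>. On the diagonal part of \<open>M\<close> it costs at least \<open>\<beta> t\<close>,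
  while on \<open>D\<close> it gains at most \<open>\<parallel>P K\<parallel> \<parallel>D\<parallel> \<le> 2 sqrt t \<parallel>D\<parallel>\<close>. Maximising over \<open>t\<close> leaves
  \<open>\<parallel>D\<parallel>\<^sup>2 / \<beta>\<close>; multiplied by \<open>\<beta>\<close>, the bound stays meaningful for \<open>\<beta> = 0\<close>. So moving \<open>M\<close>
  inside the tangent space changes the subgradient only to second order.
\<close>

lemma nuclear_norm_gap:
  fixes U :: "real^'r^'m" and V :: "real^'r^'n"
  assumes U: "transpose U ** U = mat 1" and V: "transpose V ** V = mat 1"
    and \<beta>: "\<beta> \<ge> 0" "\<And>i. \<beta> \<le> b i"
    and D: "proj_T U V D = D"
    and M: "M = U ** (\<chi> i j. if i = j then b i else 0) ** transpose V + D"
  shows "\<beta> * (nuclear_norm M - (U ** transpose V) \<bullet> M) \<le> (norm D)\<^sup>2"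
proof -
  obtain Z :: "real^'n^'m" where Z: "\<And>x. norm (Z *v x) \<le> norm x" and NM: "nuclear_norm M = Z \<bullet> M"
    using nuclear_norm_attained[of M] by blast
  define K where "K = Z - U ** transpose V"
  define t where "t = real CARD('r) - Z \<bullet> (U ** transpose V)"
  let ?b = "\<chi> i j. if i = j then b i else 0"
  have core: "transpose U ** K ** V = transpose U ** Z ** V - mat 1"
  proof -
    have "transpose U ** (U ** transpose V) ** V = mat 1"
      by (metis U V matrix_mul_assoc matrix_mul_lid)
    thus ?thesis by (simp add: K_def matrix_mult_diff_left matrix_mult_diff_right)
  qed
  have move: "K \<bullet> (U ** X ** transpose V) = (transpose U ** K ** V) \<bullet> X" for X
    by (simp add: inner_commute[of K] inner_commute[of "transpose U ** K ** V"]
        inner_matrix_mult_right[of "U ** X"] inner_matrix_mult_left[of U] matrix_mul_assoc)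
  have diag: "K \<bullet> (U ** ?b ** transpose V) \<le> - \<beta> * t"
  proof -
    let ?c = "\<lambda>i. (transpose U ** Z ** V) $ i $ i - 1"
    have "K \<bullet> (U ** ?b ** transpose V) = (\<Sum>i\<in>UNIV. ?c i * b i)"
      by (simp add: move inner_diagonal core mat_def)
    also have "\<dots> \<le> (\<Sum>i\<in>UNIV. ?c i * \<beta>)"
      using contraction_core_diag_le[OF U V Z] \<beta>(2)
      by (intro sum_mono mult_left_mono_neg) auto
    also have "\<dots> = - \<beta> * t"
    proof -
      have "(\<Sum>i\<in>UNIV. (transpose U ** Z ** V) $ i $ i) = (transpose U ** Z ** V) \<bullet> mat 1"
        using inner_diagonal[of "transpose U ** Z ** V" "\<lambda>_. 1"] by (simp add: mat_def)
      also have "\<dots> = Z \<bullet> (U ** transpose V)"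
        by (simp add: inner_matrix_mult_right[of _ V] inner_matrix_mult_left[of "transpose U"])
      finally show ?thesis
        unfolding sum_distrib_right[symmetric] by (simp add: t_def sum_subtractf algebra_simps)
    qed
    finally show ?thesis .
  qed
  define \<delta> where "\<delta> = norm D"
  define k where "k = norm (proj_T U V K)"
  have k: "k\<^sup>2 \<le> 4 * t" unfolding k_def K_def t_def by (rule norm_proj_T_misalignment[OF U V Z])
  have "K \<bullet> D = proj_T U V K \<bullet> D" using proj_T_selfadjoint[of U V K D] D by simp
  hence KD: "K \<bullet> D \<le> k * \<delta>" unfolding k_def \<delta>_def using norm_cauchy_schwarz by metis
  have "nuclear_norm M - (U ** transpose V) \<bullet> M = K \<bullet> M"
    by (simp add: NM K_def inner_diff_left)
  also have "\<dots> \<le> - \<beta> * t + k * \<delta>" using diag KD unfolding M by (simp add: inner_add_right)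
  also have "\<dots> \<le> - \<beta> * (k\<^sup>2 / 4) + k * \<delta>" using mult_left_mono[OF k \<beta>(1)] by simp
  finally have "\<beta> * (nuclear_norm M - (U ** transpose V) \<bullet> M) \<le> \<beta> * (- \<beta> * (k\<^sup>2 / 4) + k * \<delta>)"
    by (rule mult_left_mono[OF _ \<beta>(1)])
  also have "\<dots> = \<delta>\<^sup>2 - (\<beta> * k / 2 - \<delta>)\<^sup>2"
    by (simp add: power2_eq_square algebra_simps)
  also have "\<dots> \<le> \<delta>\<^sup>2" by simp
  finally show ?thesis by (simp add: \<delta>_def)
qed

section \<open>The elastic net estimator\<close>

lemma unit_mat_inner: "unit_mat w \<bullet> M = entry M w"
  by (simp add: unit_mat_def entry_def inner_axis')

lemma sampling_op_inner: "sampling_op n \<omega> M \<bullet> N = (\<Sum>i=1..n. entry M (\<omega> i) * entry N (\<omega> i))"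
  by (simp add: sampling_op_def proj_entry_def inner_sum_left unit_mat_inner)

lemma sampling_op_linear: "linear (sampling_op n \<omega>)"
  by (rule linearI)
    (simp_all add: sampling_op_def proj_entry_def entry_def sum.distrib scaleR_sum_right algebra_simps)

text \<open>
  The loss is a quadratic plus a convex function. Along the segment from \<open>X\<close> to \<open>M\<close> the loss at
  parameter \<open>t\<close> exceeds the minimum by at most \<open>t (a + t c)\<close>, where \<open>a\<close> is the difference of the
  two sides of the claim; letting \<open>t\<close> tend to zero gives \<open>a \<ge> 0\<close>. This form of the optimality
  condition avoids naming a subgradient at \<open>X\<close>.
\<close>

lemma elastic_net_variational_inequality:
  fixes X M :: "real^'d2^'d1"
  assumes min: "is_arg_min (elastic_net_loss n \<omega> y lam1 lam2) (\<lambda>M. True) X" and lam1: "lam1 \<ge> 0"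
  defines "b \<equiv> \<Sum>i=1..n. y i *\<^sub>R unit_mat (\<omega> i)"
  shows "(sampling_op n \<omega> X + lam2 *\<^sub>R X - b) \<bullet> (X - M) \<le> lam1 * (nuclear_norm M - nuclear_norm X)"
proof -
  let ?H = "sampling_op n \<omega>" and ?f = "elastic_net_loss n \<omega> y lam1 lam2"
  define D where "D = M - X"
  define a where "a = (?H X + lam2 *\<^sub>R X - b) \<bullet> D + lam1 * (nuclear_norm M - nuclear_norm X)"
  define c where "c = (?H D \<bullet> D + lam2 * (D \<bullet> D)) / 2"
  have f: "?f K = ?H K \<bullet> K / 2 - b \<bullet> K + lam1 * nuclear_norm K + lam2 / 2 * (K \<bullet> K)" for K
    by (simp add: elastic_net_loss_def sampling_op_inner b_def inner_sum_left unit_mat_inner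
        power2_norm_eq_inner power2_eq_square[of "entry _ _"] sum_divide_distrib)
  have sym: "?H D \<bullet> X = ?H X \<bullet> D" by (simp add: sampling_op_inner mult.commute)
  have key: "0 \<le> a + t * c" if t: "0 < t" "t \<le> 1" for t
  proof -
    define N where "N = X + t *\<^sub>R D"
    have "N = (1 - t) *\<^sub>R X + t *\<^sub>R M" by (simp add: N_def D_def algebra_simps)
    hence "nuclear_norm N \<le> (1 - t) * nuclear_norm X + t * nuclear_norm M"
      using nuclear_norm_convex[of t X M] t by simp
    hence "lam1 * nuclear_norm N \<le> lam1 * ((1 - t) * nuclear_norm X + t * nuclear_norm M)"
      using lam1 by (rule mult_left_mono)
    moreover have "?f X \<le> ?f N" using min by (simp add: is_arg_min_def not_less)
    moreover have "?H N \<bullet> N / 2 - b \<bullet> N + lam2 / 2 * (N \<bullet> N) =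
        ?H X \<bullet> X / 2 - b \<bullet> X + lam2 / 2 * (X \<bullet> X) + t * ((?H X + lam2 *\<^sub>R X - b) \<bullet> D) + t * (t * c)"
      by (simp add: N_def c_def linear_add[OF sampling_op_linear] linear_cmul[OF sampling_op_linear]
          inner_add_left inner_add_right inner_diff_left sym inner_commute[of D X] field_simps)
    ultimately have "0 \<le> t * (a + t * c)"
      unfolding f a_def by (simp add: algebra_simps)
    thus ?thesis using t(1) by (simp add: zero_le_mult_iff)
  qed
  have "a \<ge> 0"
  proof (rule ccontr)
    assume "\<not> a \<ge> 0"
    hence a: "a < 0" by simp
    \<comment> \<open>small enough that the quadratic term is at most half of the linear one\<close>
    define t where "t = min 1 (- a / (2 * (\<bar>c\<bar> + 1)))"
    have t: "0 < t" "t \<le> 1" using a by (auto simp: t_def divide_simps)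
    have "t * c \<le> t * (\<bar>c\<bar> + 1)" using t by (intro mult_left_mono) auto
    also have "\<dots> \<le> - a / (2 * (\<bar>c\<bar> + 1)) * (\<bar>c\<bar> + 1)" by (intro mult_right_mono) (auto simp: t_def)
    also have "\<dots> = - a / 2" by (simp add: field_simps add_nonneg_eq_0_iff)
    finally show False using key[OF t] a by simp
  qed
  thus ?thesis by (simp add: a_def D_def inner_diff_right algebra_simps)
qed

section \<open>Inverting a perturbation of the projection\<close>

text \<open>
  The map \<open>K + I\<close> is bounded below by \<open>1/2\<close>, hence bijective on the whole space; since \<open>K\<close> takes
  values in \<open>T\<close>, the preimage of a point of \<open>T\<close> is again in \<open>T\<close>, where \<open>G\<close> agrees with
  \<open>c (K + I)\<close>. The factor \<open>c\<close> lets the lemma serve both inverses in the theorem: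
  \<open>P R + P\<close>, and \<open>P H P + lam2 P\<close>, which is \<open>\<pi>\<^sub>0 + lam2\<close> times the former.
\<close>

lemma inv_into_perturbed_projection:
  fixes K P :: "'a::euclidean_space \<Rightarrow> 'a"
  assumes K: "linear K" and half: "\<And>N. norm (K N) \<le> norm N / 2"
    and T: "subspace T" and KT: "\<And>N. K N \<in> T" and P: "\<And>N. N \<in> T \<Longrightarrow> P N = N"
    and G: "\<And>N. G N = c *\<^sub>R (K N + P N)" and c: "c > 0" and w: "w \<in> T"
  defines "X \<equiv> inv_into T G w"
  shows "X \<in> T" and "c *\<^sub>R (K X + X) = w" and "norm X \<le> 2 / c * norm w"
proof -
  let ?F = "\<lambda>N. K N + N"
  have low: "norm N \<le> 2 * norm (?F N)" for N
    using half[of N] norm_triangle_ineq4[of "?F N" "K N"] by simp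
  have lin: "linear ?F" 
    by (rule linearI) (simp_all add: linear_add[OF K] linear_cmul[OF K] algebra_simps)
  have "inj ?F"
    unfolding linear_injective_0[OF lin]
  proof (intro allI impI)
    fix N assume "K N + N = 0"
    thus "N = 0" using low[of N] by simp
  qed
  hence "surj ?F" using lin linear_injective_imp_surjective by blast
  from surjD[OF this, of "w /\<^sub>R c"] obtain N where N: "?F N = w /\<^sub>R c" by auto
  have "N = w /\<^sub>R c - K N" unfolding N[symmetric] by simp
  also have "\<dots> \<in> T" using T w KT by (intro subspace_diff subspace_scale)
  finally have NT: "N \<in> T" .
  hence "G N = c *\<^sub>R ?F N" by (simp add: G P)
  hence "G N = w" unfolding N using c by simp
  hence wG: "w \<in> G ` T" using NT by blast
  show XT: "X \<in> T" unfolding X_def using wG by (rule inv_into_into)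
  have "G X = w" unfolding X_def using wG by (rule f_inv_into_f)
  thus eq: "c *\<^sub>R (K X + X) = w" using XT by (simp add: G P)
  have "norm w = c * norm (?F X)" using c by (simp add: eq[symmetric])
  thus "norm X \<le> 2 / c * norm w" using low[of X] c by simp
qed

section \<open>The error bound\<close>

theorem theorem2:
  fixes \<Theta> \<Theta>til \<Theta>hat \<Delta>bar \<epsilon> :: "real^'d2^'d1"
    and U :: "real^('r::{finite,linorder})^'d1"
    and V :: "real^('r::{finite,linorder})^'d2"
    and s :: "'r \<Rightarrow> real"
    and n :: nat
    and \<omega> :: "nat \<Rightarrow> 'd1 \<times> 'd2"
    and y e :: "nat \<Rightarrow> real"
    and lam1 lam2 \<pi>\<^sub>0 :: real
    and H P R Q :: "real^'d2^'d1 \<Rightarrow> real^'d2^'d1"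
    and T :: "(real^'d2^'d1) set"
  assumes "n \<ge> 1"
    and "rank \<Theta> = CARD('r)"
    and "compact_svd \<Theta> U s V"
    and "\<And>i. i \<in> {1..n} \<Longrightarrow> y i = entry \<Theta> (\<omega> i) + e i"
    and "lam1 \<ge> 0" and "lam2 > 0"
    and "\<pi>\<^sub>0 = real n / (real CARD('d1) * real CARD('d2))"
    and "is_arg_min (elastic_net_loss n \<omega> y lam1 lam2) (\<lambda>M. True) \<Theta>til"
    and "\<Theta>hat = (1 + lam2 / \<pi>\<^sub>0) *\<^sub>R \<Theta>til"
    and "H = sampling_op n \<omega>"
    and "T = tangent_space U V"
    and "P = proj_T U V"
    and "R = (\<lambda>M. (H (P M) - \<pi>\<^sub>0 *\<^sub>R P M) /\<^sub>R (\<pi>\<^sub>0 + lam2))"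
    and "\<Delta>bar = R (lam2 *\<^sub>R \<Theta> + lam1 *\<^sub>R (U ** transpose V))"
    and "Q = (\<lambda>M. M - H (inv_into T (\<lambda>N. P (H (P N)) + lam2 *\<^sub>R P N) (P M)))"
    and "\<epsilon> = (\<Sum>i=1..n. e i *\<^sub>R unit_mat (\<omega> i))"
    and "onorm (P \<circ> R) \<le> 1 / 2"
    and "s (Max UNIV) \<ge> 5 * lam1 / lam2"
    and "norm (P \<Delta>bar) \<le> sqrt (real CARD('r)) * lam1 / 8"
    and "spectral_norm (\<Delta>bar - R (inv_into T (\<lambda>N. P (R N) + P N) (P \<Delta>bar))) \<le> lam1 / 4"
    and "norm (P \<epsilon>) \<le> sqrt (real CARD('r)) * lam1 / 8"
    and "spectral_norm (Q \<epsilon>) \<le> 3 * lam1 / 4"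
    and "spectral_norm (\<epsilon> - P \<epsilon>) \<le> lam1"
  shows "norm (\<Theta>hat - \<Theta>) \<le> 2 * sqrt (real CARD('r)) * lam1 / \<pi>\<^sub>0"
proof -
  let ?UV = "U ** transpose V" and ?r = "sqrt (real CARD('r))"
  define S where "S = \<pi>\<^sub>0 + lam2"
  note lam1 = \<open>lam1 \<ge> 0\<close> and lam2 = \<open>lam2 > 0\<close>
  have \<pi>: "\<pi>\<^sub>0 > 0" using \<open>n \<ge> 1\<close> by (simp add: \<open>\<pi>\<^sub>0 = _\<close>)
  have S: "S > 0" using \<pi> lam2 by (simp add: S_def)
  have U: "transpose U ** U = mat 1" and V: "transpose V ** V = mat 1"
    and spos: "\<And>i. s i > 0" and santi: "antimono s"
    and \<Theta>: "\<Theta> = U ** (\<chi> i j. if i = j then s i else 0) ** transpose V"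
    using \<open>compact_svd \<Theta> U s V\<close> by (auto simp: compact_svd_def)
  have Hlin: "linear H" by (simp add: \<open>H = _\<close> sampling_op_linear)
  have Hsym: "H M \<bullet> N = H N \<bullet> M" for M N
    by (simp add: \<open>H = _\<close> sampling_op_inner mult.commute)
  have Hpos: "0 \<le> H M \<bullet> M" for M
    by (simp add: \<open>H = _\<close> sampling_op_inner sum_nonneg)
  have Plin: "linear P" by (simp add: \<open>P = _\<close> proj_T_linear)
  have PP: "P (P M) = P M" for M
    using proj_T_eq_self[OF U V proj_T_in_tangent_space] by (simp add: \<open>P = _\<close>)
  have Psym: "P M \<bullet> N = M \<bullet> P N" for M N by (simp add: \<open>P = _\<close> proj_T_selfadjoint)
  have T_iff: "M \<in> T \<longleftrightarrow> P M = M" for M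
    by (simp add: \<open>P = _\<close> \<open>T = _\<close> tangent_space_iff[OF U V])
  have T: "subspace T"
    by (auto simp: subspace_def T_iff linear_0[OF Plin] linear_add[OF Plin] linear_cmul[OF Plin])
  note lin = linear_add[OF Plin] linear_diff[OF Plin] linear_cmul[OF Plin]
    linear_add[OF Hlin] linear_diff[OF Hlin] linear_cmul[OF Hlin]
  have diagT: "P (U ** A ** transpose V) = U ** A ** transpose V" for A
  proof -
    have "U ** transpose U ** (U ** A ** transpose V) = U ** A ** transpose V"
      by (metis U matrix_mul_assoc matrix_mul_rid)
    moreover have "U ** A ** transpose V ** V ** transpose V = U ** A ** transpose V"
      by (metis V matrix_mul_assoc matrix_mul_rid)
    ultimately show ?thesis by (simp add: \<open>P = _\<close> proj_T_def)
  qed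
  have P\<Theta>: "P \<Theta> = \<Theta>" unfolding \<Theta> by (rule diagT)
  have PUV: "P ?UV = ?UV" using diagT[of "mat 1"] by simp
  have nUV: "norm ?UV = ?r"
  proof -
    have "(norm ?UV)\<^sup>2 = (norm (transpose V))\<^sup>2"
      by (simp add: power2_norm_eq_inner inner_matrix_mult_left matrix_mul_assoc U)
    also have "\<dots> = real CARD('r)"
      by (simp add: norm_transpose norm_orthonormal_columns_sq[OF V])
    finally show ?thesis by (metis norm_ge_zero real_sqrt_unique)
  qed

  define K where "K = (\<lambda>M. P (R M))"
  have R: "R M = (1 / S) *\<^sub>R (H (P M) - \<pi>\<^sub>0 *\<^sub>R P M)" for M
    by (simp add: \<open>R = _\<close> S_def divide_inverse_commute)
  have Klin: "linear K"
    by (rule linearI) (simp_all add: K_def R lin algebra_simps)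
  have K_half: "norm (K M) \<le> norm M / 2" for M
  proof -
    have "norm (K M) \<le> onorm K * norm M"
      using Klin by (intro onorm linear_conv_bounded_linear[THEN iffD1])
    also have "\<dots> \<le> 1 / 2 * norm M"
      using \<open>onorm (P \<circ> R) \<le> 1 / 2\<close> by (intro mult_right_mono) (simp_all add: K_def comp_def)
    finally show ?thesis by simp
  qed
  have KT: "K M \<in> T" for M by (simp add: K_def T_iff PP)
  \<comment> \<open>on \<open>T\<close>, the compression of \<open>H + lam2 I\<close> is within a factor of two of \<open>S I\<close>\<close>
  have PJ: "P (H M) + lam2 *\<^sub>R M = S *\<^sub>R (K M + M)" if "P M = M" for M
  proof -
    have "S *\<^sub>R K M = P (H M) - \<pi>\<^sub>0 *\<^sub>R M"
      using S that by (simp add: K_def R lin)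
    thus ?thesis by (simp add: S_def algebra_simps)
  qed

  define A where "A = inv_into T (\<lambda>N. P (R N) + P N) (P \<Delta>bar)"
  define C where "C = inv_into T (\<lambda>N. P (H (P N)) + lam2 *\<^sub>R P N) (P \<epsilon>)"
  have PT: "P M \<in> T" for M by (simp add: T_iff PP)
  have A: "A \<in> T" "K A + A = P \<Delta>bar" "norm A \<le> 2 * norm (P \<Delta>bar)"
    using inv_into_perturbed_projection[OF Klin K_half T KT, of P "\<lambda>N. P (R N) + P N" 1 "P \<Delta>bar"]
    by (simp_all add: A_def K_def T_iff PP)
  have C: "C \<in> T" "S *\<^sub>R (K C + C) = P \<epsilon>" "norm C \<le> 2 / S * norm (P \<epsilon>)"
  proof -
    have "P (H (P N)) + lam2 *\<^sub>R P N = S *\<^sub>R (K N + P N)" for N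
      using PJ[of "P N"] by (simp add: K_def R PP)
    from inv_into_perturbed_projection[OF Klin K_half T KT _ this S PT]
    show "C \<in> T" "S *\<^sub>R (K C + C) = P \<epsilon>" "norm C \<le> 2 / S * norm (P \<epsilon>)"
      by (simp_all add: C_def T_iff)
  qed
  \<comment> \<open>the correction \<open>D\<close> is the sum of the bias part \<open>A / S\<close> and the noise part \<open>C\<close>;
    they are kept apart because the spectral assumptions treat them separately\<close>
  define D where "D = (1 / S) *\<^sub>R A + C"
  have DT: "P D = D" using A(1) C(1) by (simp add: D_def T_iff lin)
  have KD: "S *\<^sub>R (K D + D) = P \<Delta>bar + P \<epsilon>"
    using S A(2) C(2) by (simp add: D_def linear_add[OF Klin] linear_cmul[OF Klin] algebra_simps)
  have nPP: "norm (P \<Delta>bar + P \<epsilon>) \<le> ?r * lam1 / 4"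
    using norm_triangle_ineq[of "P \<Delta>bar" "P \<epsilon>"] \<open>norm (P \<Delta>bar) \<le> _\<close> \<open>norm (P \<epsilon>) \<le> _\<close> by simp
  have nD: "norm D \<le> ?r * lam1 / (2 * S)"
  proof -
    have "norm D \<le> (1 / S) * norm A + norm C"
      using norm_triangle_ineq[of "(1 / S) *\<^sub>R A" C] S by (simp add: D_def)
    also have "\<dots> \<le> (1 / S) * (2 * (?r * lam1 / 8)) + 2 / S * (?r * lam1 / 8)"
    proof (intro add_mono mult_left_mono order_trans[OF C(3)])
      show "norm A \<le> 2 * (?r * lam1 / 8)"
        using A(3) \<open>norm (P \<Delta>bar) \<le> _\<close> by linarith
    qed (use S \<open>norm (P \<epsilon>) \<le> _\<close> in auto)
    finally show ?thesis by (simp add: field_simps)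
  qed

  \<comment> \<open>the oracle, the right-hand side of the normal equations, and the residual of the oracle\<close>
  define X where "X = (1 / S) *\<^sub>R (\<pi>\<^sub>0 *\<^sub>R \<Theta> - lam1 *\<^sub>R ?UV) + D"
  define b where "b = H \<Theta> + \<epsilon>"
  define W where "W = \<Delta>bar + \<epsilon> - H D - lam2 *\<^sub>R D"
  have \<Delta>: "\<Delta>bar = (1 / S) *\<^sub>R (H (lam2 *\<^sub>R \<Theta> + lam1 *\<^sub>R ?UV) - \<pi>\<^sub>0 *\<^sub>R (lam2 *\<^sub>R \<Theta> + lam1 *\<^sub>R ?UV))"
    by (simp add: \<open>\<Delta>bar = _\<close> R lin P\<Theta> PUV)
  have HX: "H X + lam2 *\<^sub>R X - b = - (lam1 *\<^sub>R ?UV + W)"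
  proof -
    have "S *\<^sub>R (H X + lam2 *\<^sub>R X - b) = S *\<^sub>R (- (lam1 *\<^sub>R ?UV + W))"
      using S by (simp add: X_def b_def W_def \<Delta> lin algebra_simps)
        (simp add: S_def algebra_simps)
    thus ?thesis using S by simp
  qed
  have PW: "P W = 0"
    using PJ[OF DT] KD by (simp add: W_def lin DT algebra_simps)
  \<comment> \<open>the two matrices whose spectral norms are assumed small; their sum differs from \<open>W\<close> only
    inside \<open>T\<close>, which the complementary projection removes\<close>
  define N where "N = Q \<epsilon> + (\<Delta>bar - R A)"
  have W: "W = N - P N"
  proof -
    have "N = \<epsilon> - H C + \<Delta>bar - (1 / S) *\<^sub>R (H A - \<pi>\<^sub>0 *\<^sub>R A)"
      using A(1) by (simp add: N_def \<open>Q = _\<close> C_def R T_iff)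
    hence "N = W + lam2 *\<^sub>R D + (\<pi>\<^sub>0 / S) *\<^sub>R A"
      by (simp add: W_def D_def lin algebra_simps)
    thus ?thesis using A(1) PW by (simp add: lin DT T_iff)
  qed
  have certificate: "norm ((lam1 *\<^sub>R ?UV + W) *v x) \<le> lam1 * norm x" for x
  proof -
    have "norm (N *v x) \<le> lam1 * norm x" for x
    proof -
      have "norm (N *v x) \<le> norm (Q \<epsilon> *v x) + norm ((\<Delta>bar - R A) *v x)"
        by (simp add: N_def matrix_vector_mult_add_rdistrib norm_triangle_ineq)
      also have "\<dots> \<le> spectral_norm (Q \<epsilon>) * norm x + spectral_norm (\<Delta>bar - R A) * norm x"
        by (intro add_mono norm_matrix_vector_le_spectral_norm)
      also have "\<dots> \<le> 3 * lam1 / 4 * norm x + lam1 / 4 * norm x"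
        using \<open>spectral_norm (Q \<epsilon>) \<le> _\<close> \<open>spectral_norm (\<Delta>bar - _) \<le> _\<close>
        by (intro add_mono mult_right_mono) (simp_all add: A_def)
      finally show ?thesis by (simp add: field_simps)
    qed
    thus ?thesis unfolding W \<open>P = _\<close> by (rule norm_certificate_mult_vector_le[OF U V lam1])
  qed
  have dual: "(lam1 *\<^sub>R ?UV + W) \<bullet> M \<le> lam1 * nuclear_norm M" for M
    by (rule inner_le_nuclear_norm[OF certificate])
  have b: "b = (\<Sum>i=1..n. y i *\<^sub>R unit_mat (\<omega> i))"
  proof -
    have "b = (\<Sum>i=1..n. (entry \<Theta> (\<omega> i) + e i) *\<^sub>R unit_mat (\<omega> i))"
      by (simp add: b_def \<open>H = _\<close> \<open>\<epsilon> = _\<close> sampling_op_def proj_entry_def scaleR_add_left sum.distrib)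
    also have "\<dots> = (\<Sum>i=1..n. y i *\<^sub>R unit_mat (\<omega> i))"
      using \<open>\<And>i. i \<in> {1..n} \<Longrightarrow> y i = _ i\<close> by (intro sum.cong) auto
    finally show ?thesis .
  qed
  define J where "J = (\<lambda>M. H M + lam2 *\<^sub>R M)"
  have gap: "J (\<Theta>til - X) \<bullet> (\<Theta>til - M) \<le> lam1 * (nuclear_norm M - ?UV \<bullet> M)" if "P M = M" for M
  proof -
    have "(H \<Theta>til + lam2 *\<^sub>R \<Theta>til - b) \<bullet> (\<Theta>til - M) \<le> lam1 * (nuclear_norm M - nuclear_norm \<Theta>til)"
      unfolding \<open>H = _\<close> b
      by (rule elastic_net_variational_inequality[OF \<open>is_arg_min _ _ _\<close> lam1])
    moreover have "H \<Theta>til + lam2 *\<^sub>R \<Theta>til - b = J (\<Theta>til - X) - (lam1 *\<^sub>R ?UV + W)"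
      using HX by (simp add: J_def lin algebra_simps)
    moreover have "W \<bullet> M = 0" using Psym[of W M] PW that by simp
    ultimately show ?thesis using dual[of \<Theta>til]
      by (simp add: inner_diff_left inner_diff_right inner_add_left algebra_simps)
  qed
  have Jlow: "lam2 * (norm M)\<^sup>2 \<le> J M \<bullet> M" for M
    using Hpos[of M] by (simp add: J_def inner_add_left power2_norm_eq_inner)

  \<comment> \<open>the point from which the calibration factor \<open>S / \<pi>\<^sub>0\<close> recovers \<open>\<Theta>\<close>\<close>
  define M0 where "M0 = (\<pi>\<^sub>0 / S) *\<^sub>R \<Theta>"
  have PM0: "P M0 = M0" by (simp add: M0_def lin P\<Theta>)
  have diag_scale: "U ** (\<chi> i j. if i = j then p * s i - q else 0) ** transpose V = p *\<^sub>R \<Theta> - q *\<^sub>R ?UV"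
    for p q :: real
  proof -
    have "(\<chi> i j. if i = j then p * s i - q else 0) =
        p *\<^sub>R (\<chi> i j. if i = j then s i else 0) - q *\<^sub>R mat 1"
      by (simp add: vec_eq_iff mat_def)
    thus ?thesis
      by (simp add: \<Theta> matrix_mult_diff_left matrix_mult_diff_right matrix_mult_scaleR_left matrix_mult_scaleR_right)
  qed
  have smin: "s (Max UNIV) \<le> s i" for i using santi by (simp add: antimonoD)
  have goal: "norm (\<Theta>til - M0) \<le> 2 * ?r * lam1 / S"
  proof (cases "lam2 \<le> 2 * \<pi>\<^sub>0")
    case True
    \<comment> \<open>the smallest soft-thresholded singular value; the factor \<open>5\<close> and \<open>lam2 \<le> 2 \<pi>\<^sub>0\<close> combine as
      \<open>5 \<pi>\<^sub>0 - lam2 \<ge> \<pi>\<^sub>0 + lam2\<close>\<close>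
    define \<beta> where "\<beta> = (\<pi>\<^sub>0 * s (Max UNIV) - lam1) / S"
    have "5 * lam1 \<le> lam2 * s (Max UNIV)"
      using \<open>s (Max UNIV) \<ge> 5 * lam1 / lam2\<close> lam2 by (simp add: field_simps)
    hence "5 * lam1 * \<pi>\<^sub>0 \<le> lam2 * s (Max UNIV) * \<pi>\<^sub>0" using \<pi> by (intro mult_right_mono) auto
    moreover have "lam1 * (2 * lam2) \<le> lam1 * (4 * \<pi>\<^sub>0)" using lam1 True by (intro mult_left_mono) auto
    ultimately have "lam1 * S \<le> lam2 * (\<pi>\<^sub>0 * s (Max UNIV) - lam1)"
      by (simp add: S_def algebra_simps)
    hence \<beta>: "lam1 \<le> lam2 * \<beta>" using S by (simp add: \<beta>_def field_simps)
    hence \<beta>0: "\<beta> \<ge> 0" using lam1 lam2 by (smt (verit) mult_pos_neg)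
    define g where "g = nuclear_norm X - ?UV \<bullet> X"
    have "X = U ** (\<chi> i j. if i = j then \<pi>\<^sub>0 / S * s i - lam1 / S else 0) ** transpose V + D"
      unfolding diag_scale by (simp add: X_def scaleR_diff_right)
    moreover have "\<beta> \<le> \<pi>\<^sub>0 / S * s i - lam1 / S" for i
      using smin[of i] \<pi> S by (simp add: \<beta>_def diff_divide_distrib divide_right_mono)
    ultimately have \<beta>g: "\<beta> * g \<le> (norm D)\<^sup>2"
      unfolding g_def using DT by (intro nuclear_norm_gap[OF U V \<beta>0]) (auto simp: \<open>P = _\<close>)
    have "norm (?UV *v x) \<le> 1 * norm x" for x
      using norm_certificate_mult_vector_le[OF U V, of 1 0 x]
      by (simp add: \<open>P = _\<close>[symmetric] linear_0[OF Plin])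
    hence "g \<ge> 0" using inner_le_nuclear_norm[of ?UV 1 X] by (simp add: g_def)
    have PX: "P X = X" by (simp add: X_def lin P\<Theta> PUV DT)
    have "lam2 * (norm (\<Theta>til - X))\<^sup>2 \<le> lam1 * g"
      using Jlow[of "\<Theta>til - X"] gap[OF PX] by (simp add: g_def)
    also have "\<dots> \<le> lam2 * \<beta> * g" using \<beta> \<open>g \<ge> 0\<close> by (rule mult_right_mono)
    also have "\<dots> \<le> lam2 * (norm D)\<^sup>2" using \<beta>g lam2 by simp
    finally have "(norm (\<Theta>til - X))\<^sup>2 \<le> (norm D)\<^sup>2" using lam2 by simp
    hence "norm (\<Theta>til - X) \<le> norm D" by (rule power2_le_imp_le) simp
    moreover have "norm (\<Theta>til - M0) \<le> norm (\<Theta>til - X) + norm D + lam1 / S * ?r"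
    proof -
      have eq: "\<Theta>til - M0 = ((\<Theta>til - X) + D) - (lam1 / S) *\<^sub>R ?UV"
        by (simp add: X_def M0_def scaleR_diff_right)
      show ?thesis
        unfolding eq
        using norm_triangle_ineq4[of "(\<Theta>til - X) + D" "(lam1 / S) *\<^sub>R ?UV"]
          norm_triangle_ineq[of "\<Theta>til - X" D] lam1 S by (simp add: nUV)
    qed
    ultimately have "norm (\<Theta>til - M0) \<le> 2 * (?r * lam1 / (2 * S)) + lam1 / S * ?r"
      using nD by linarith
    also have "\<dots> = 2 * ?r * lam1 / S" by (simp add: field_simps)
    finally show ?thesis .
  next
    case False
    define B where "B = X - M0"
    have B: "B = D - (lam1 / S) *\<^sub>R ?UV" by (simp add: B_def X_def M0_def scaleR_diff_right)
    have PB: "P B = B" by (simp add: B lin DT PUV)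
    define Y where "Y = \<Theta>til - M0"
    have "nuclear_norm M0 - ?UV \<bullet> M0 \<le> 0"
    proof -
      define \<beta> where "\<beta> = \<pi>\<^sub>0 / S * s (Max UNIV)"
      have \<beta>: "\<beta> > 0" using \<pi> S spos by (simp add: \<beta>_def)
      have "M0 = U ** (\<chi> i j. if i = j then \<pi>\<^sub>0 / S * s i - 0 else 0) ** transpose V + 0"
        unfolding diag_scale by (simp add: M0_def)
      moreover have "\<beta> \<le> \<pi>\<^sub>0 / S * s i - 0" for i
        using smin[of i] \<pi> S by (simp add: \<beta>_def divide_right_mono)
      ultimately have "\<beta> * (nuclear_norm M0 - ?UV \<bullet> M0) \<le> (norm (0 :: real^'d2^'d1))\<^sup>2"
        using \<beta> linear_0[OF Plin] by (intro nuclear_norm_gap[OF U V]) (auto simp: \<open>P = _\<close>)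
      thus ?thesis using \<beta> by (simp add: mult_le_0_iff)
    qed
    hence "lam1 * (nuclear_norm M0 - ?UV \<bullet> M0) \<le> 0" using lam1 by (simp add: mult_nonneg_nonpos)
    hence "J (Y - B) \<bullet> Y \<le> 0" using gap[OF PM0] by (simp add: Y_def B_def)
    moreover have "0 \<le> J (Y - B) \<bullet> (Y - B)"
      using Jlow[of "Y - B"] lam2 by (smt (verit) mult_nonneg_nonneg zero_le_power2)
    moreover have "J B \<bullet> Y = J Y \<bullet> B"
      using Hsym[of B Y] by (simp add: J_def inner_add_left inner_add_right inner_commute)
    \<comment> \<open>from \<open>\<langle>J Y, Y\<rangle> \<le> \<langle>J B, Y\<rangle>\<close> and positivity of \<open>J\<close> at \<open>Y - B\<close>\<close>
    ultimately have "J Y \<bullet> Y \<le> J B \<bullet> B"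
      by (simp add: J_def lin algebra_simps inner_add_left inner_diff_left inner_diff_right)
    also have "J B \<bullet> B = (S *\<^sub>R (K B + B)) \<bullet> B"
      unfolding PJ[OF PB, symmetric] by (simp add: J_def inner_add_left Psym PB)
    also have "\<dots> \<le> norm (S *\<^sub>R (K B + B)) * norm B" by (rule norm_cauchy_schwarz)
    \<comment> \<open>\<open>7/4 = 1/4 + 3/2\<close> from noise and bias plus \<open>(P R + I) U V\<^sup>T\<close>; \<open>3/2 = 1/2 + 1\<close> from \<open>D\<close> plus the
      thresholding shift\<close>
    also have "\<dots> \<le> (7 / 4 * (?r * lam1)) * (3 / 2 * (?r * lam1) / S)"
    proof (intro mult_mono)
      have "S *\<^sub>R (K B + B) = (P \<Delta>bar + P \<epsilon>) - lam1 *\<^sub>R (K ?UV + ?UV)"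
        using S unfolding KD[symmetric]
        by (simp add: B linear_diff[OF Klin] linear_cmul[OF Klin] algebra_simps)
      hence "norm (S *\<^sub>R (K B + B)) \<le> norm (P \<Delta>bar + P \<epsilon>) + lam1 * norm (K ?UV + ?UV)"
        using norm_triangle_ineq4[of "P \<Delta>bar + P \<epsilon>" "lam1 *\<^sub>R (K ?UV + ?UV)"] lam1 by simp
      moreover have "norm (K ?UV + ?UV) \<le> 3 / 2 * ?r"
        using norm_triangle_ineq[of "K ?UV" ?UV] K_half[of ?UV] nUV by simp
      hence "lam1 * norm (K ?UV + ?UV) \<le> lam1 * (3 / 2 * ?r)" using lam1 by (rule mult_left_mono)
      ultimately show "norm (S *\<^sub>R (K B + B)) \<le> 7 / 4 * (?r * lam1)"
        using nPP by (simp add: algebra_simps)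
      have "norm B \<le> norm D + lam1 / S * ?r"
        using norm_triangle_ineq4[of D "(lam1 / S) *\<^sub>R ?UV"] lam1 S by (simp add: B nUV)
      also have "\<dots> \<le> ?r * lam1 / (2 * S) + lam1 / S * ?r" using nD by (rule add_right_mono)
      also have "\<dots> = 3 / 2 * (?r * lam1) / S" by (simp add: field_simps)
      finally show "norm B \<le> 3 / 2 * (?r * lam1) / S" .
    qed (use lam1 in auto)
    finally have JY: "J Y \<bullet> Y \<le> 21 / 8 * (?r * lam1)\<^sup>2 / S" by (simp add: power2_eq_square)
    have "lam2 * (norm Y)\<^sup>2 \<le> 21 / 8 * (?r * lam1)\<^sup>2 / S" using Jlow[of Y] JY by linarith
    also have "\<dots> \<le> lam2 * (4 * (?r * lam1)\<^sup>2 / S\<^sup>2)"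
    proof -
      \<comment> \<open>\<open>S < 3 lam2 / 2\<close>, and \<open>21/8 * 3/2 = 63/16 < 4\<close>\<close>
      have "21 / 8 * S \<le> lam2 * 4" using False \<pi> lam2 by (simp add: S_def)
      hence "21 / 8 * S * ((?r * lam1)\<^sup>2 / S\<^sup>2) \<le> lam2 * 4 * ((?r * lam1)\<^sup>2 / S\<^sup>2)"
        by (rule mult_right_mono) simp
      thus ?thesis using S by (simp add: power2_eq_square)
    qed
    also have "\<dots> = lam2 * (2 * ?r * lam1 / S)\<^sup>2"
      by (simp add: power_mult_distrib power_divide)
    finally have "(norm Y)\<^sup>2 \<le> (2 * ?r * lam1 / S)\<^sup>2" using lam2 by (simp del: power_mult_distrib)
    thus ?thesis unfolding Y_def by (rule power2_le_imp_le) (use lam1 S in simp)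
  qed
  have "\<Theta>hat - \<Theta> = (S / \<pi>\<^sub>0) *\<^sub>R (\<Theta>til - M0)"
  proof -
    have "1 + lam2 / \<pi>\<^sub>0 = S / \<pi>\<^sub>0" using \<pi> by (simp add: S_def field_simps)
    moreover have "(S / \<pi>\<^sub>0) *\<^sub>R M0 = \<Theta>" using \<pi> S by (simp add: M0_def)
    ultimately show ?thesis by (simp add: \<open>\<Theta>hat = _\<close> scaleR_diff_right)
  qed
  hence "norm (\<Theta>hat - \<Theta>) = S / \<pi>\<^sub>0 * norm (\<Theta>til - M0)" using \<pi> S by simp
  also have "\<dots> \<le> S / \<pi>\<^sub>0 * (2 * ?r * lam1 / S)"
    using goal \<pi> S by (intro mult_left_mono) auto
  also have "\<dots> = 2 * ?r * lam1 / \<pi>\<^sub>0" using S by simp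
  finally show ?thesis .
qed

end
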